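(* For any countable ordinal $\xi\geq 3$ there exists a $\boldsymbol\Pi^0_\xi$ set $X_\xi\subset 2^\omega\times[0,1]$ for which the set $\mathcal F_0(X_\xi)$ is $\Game\boldsymbol\Sigma^0_\xi$-hard.
   Context: All spaces are separable metrizable. A space is zero-dimensional if it has a basis of clopen sets; the empty space counts as zero-dimensional. $\boldsymbol\Sigma^0_\xi,\boldsymbol\Pi^0_\xi$ are the additive and multiplicative Borel classes of rank $\xi$. $\mathcal F(X)$ is the set of all closed subsets of $X$, and $\mathcal F_0(X)\subset\mathcal F(X)$ is the set of all zero-dimensional closed subsets of $X$. $\mathcal F(X)$ is endowed with an admissible topology: take a compact metrizable space $\hat X\supset X$ (with $X$ a subspace, not necessarily dense), identify $F\in\mathcal F(X)$ with its closure $\overline F$ in $\hat X$, and give $\mathcal F(X)$ the topology induced by the Vietoris (Hausdorff metric) topology on the compact subsets of $\hat X$; an admissible topology is one obtained in this way from some $\hat X$. Game classes: for $A\subset\omega^\omega$, $\mathbf G_A$ is the game in which Players I and II alternately choose $n_0$ (I), $n_1$ (II), $n_2$ (I), $\dots$ in $\omega$, and Player I wins iff $(n_0,n_1,n_2,\dots)\in A$. For a Polish space $Z$ and $B\subset Z\times\omega^\omega$ put $B(z)=\{\gamma:(z,\gamma)\in B\}$ and $\Game B=\{z\in Z:\text{Player I has a winning strategy in }\mathbf G_{B(z)}\}$. A set $A\subset Z$ is in $\Game\Gamma$ if $A=\Game B$ for some $B\subset Z\times\omega^\omega$ in $\Gamma$. For a class $\Gamma$, $\mathcal F_0(X)$ is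 $\Gamma$-hard if for every $A\subset 2^\omega$ in $\Gamma$ there is a continuous $\varphi:2^\omega\to\mathcal F(X)$ with $A=\varphi^{-1}(\mathcal F_0(X))$. *)

theory Defs
  imports "HOL-Analysis.Analysis"
begin

text \<open>
  A countable ordinal is represented by an element \<open>\<xi>\<close> of the field of a well-order \<open>r\<close> for which
  \<open>underS r \<xi>\<close> is countable; it stands for the order type of \<open>underS r \<xi>\<close>.  With \<open>r\<close> ranging over
  the well-orders on subsets of \<open>nat\<close> one already obtains every countable ordinal.
\<close>

definition rank_ge :: "'o rel \<Rightarrow> 'o \<Rightarrow> nat \<Rightarrow> bool" where
  "rank_ge r \<xi> n \<longleftrightarrow> infinite (underS r \<xi>) \<or> n \<le> card (underS r \<xi>)"

text \<open>
  Ranks start at 1, as usual: the element of \<open>r\<close> with exactly one strict predecessor has rank 1.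
  There is no set of rank 0 (neither rule applies), so in the second rule the ranks \<open>\<eta> n\<close> are
  at least 1, and that rule applies only when \<open>\<xi>\<close> has rank at least 2.
\<close>

inductive sigma0 :: "'o rel \<Rightarrow> 'a topology \<Rightarrow> 'o \<Rightarrow> 'a set \<Rightarrow> bool"
  for r :: "'o rel" and T :: "'a topology" where
  sigma0_open: "card (underS r \<xi>) = 1 \<Longrightarrow> openin T U \<Longrightarrow> sigma0 r T \<xi> U"
| sigma0_Union: "(\<And>n::nat. \<eta> n \<in> underS r \<xi> \<and> sigma0 r T (\<eta> n) (B n)) \<Longrightarrow>
     sigma0 r T \<xi> (\<Union>n. topspace T - B n)"

definition pi0 :: "'o rel \<Rightarrow> 'a topology \<Rightarrow> 'o \<Rightarrow> 'a set \<Rightarrow> bool" where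
  "pi0 r T \<xi> A \<longleftrightarrow> A \<subseteq> topspace T \<and> sigma0 r T \<xi> (topspace T - A)"

text \<open>
  In the game \<open>G\<^sub>A\<close> Player I chooses the even-indexed terms of the play; a strategy for I maps
  the (even-length) list of all previous moves to the next move.
\<close>

definition player_I_wins :: "(nat \<Rightarrow> nat) set \<Rightarrow> bool" where
  "player_I_wins A \<longleftrightarrow>
     (\<exists>\<sigma> :: nat list \<Rightarrow> nat. \<forall>\<gamma>. (\<forall>k. \<gamma> (2 * k) = \<sigma> (map \<gamma> [0..<2 * k])) \<longrightarrow> \<gamma> \<in> A)"

definition game_set :: "'z topology \<Rightarrow> ('z \<times> (nat \<Rightarrow> nat)) set \<Rightarrow> 'z set" where
  "game_set Z B = {z \<in> topspace Z. player_I_wins {\<gamma>. (z, \<gamma>) \<in> B}}"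

definition game_class ::
  "(('z \<times> (nat \<Rightarrow> nat)) topology \<Rightarrow> ('z \<times> (nat \<Rightarrow> nat)) set \<Rightarrow> bool) \<Rightarrow>
     'z topology \<Rightarrow> 'z set \<Rightarrow> bool" where
  "game_class \<Gamma> Z A \<longleftrightarrow> (\<exists>B. \<Gamma> (prod_topology Z euclidean) B \<and> A = game_set Z B)"

definition zero_dimensional :: "'a topology \<Rightarrow> bool" where
  "zero_dimensional X \<longleftrightarrow>
     (\<exists>\<B>. (\<forall>B\<in>\<B>. openin X B \<and> closedin X B) \<and>
          (\<forall>U x. openin X U \<and> x \<in> U \<longrightarrow> (\<exists>B\<in>\<B>. x \<in> B \<and> B \<subseteq> U)))"

lemma zero_dimensional_iff_dim_le_0: "zero_dimensional X \<longleftrightarrow> X dim_le 0"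
  unfolding dimension_le_0_neighbourhood_base_of_clopen zero_dimensional_def
proof (subst open_neighbourhood_base_of, force, safe)
  fix W x
  assume "\<forall>W x. openin X W \<and> x \<in> W \<longrightarrow>
    (\<exists>U. (closedin X U \<and> openin X U) \<and> x \<in> U \<and> U \<subseteq> W)"
  then show "\<exists>\<B>. (\<forall>B\<in>\<B>. openin X B \<and> closedin X B) \<and>
          (\<forall>U x. openin X U \<and> x \<in> U \<longrightarrow> (\<exists>B\<in>\<B>. x \<in> B \<and> B \<subseteq> U))"
    by (intro exI[of _ "{U. openin X U \<and> closedin X U}"]) blast
qed metis

definition closed_subsets :: "'a topology \<Rightarrow> 'a set set" where
  "closed_subsets X = {F. closedin X F}"

definition zero_dim_closed_subsets :: "'a topology \<Rightarrow> 'a set set" where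
  "zero_dim_closed_subsets X = {F. closedin X F \<and> zero_dimensional (subtopology X F)}"

definition vietoris :: "'a topology \<Rightarrow> 'a set topology" where
  "vietoris T = topology_generated_by
     ({{K. compactin T K \<and> K \<subseteq> U} | U. openin T U} \<union>
      {{K. compactin T K \<and> K \<inter> U \<noteq> {}} | U. openin T U})"

text \<open>
  The compact space \<open>Y\<close> containing \<open>X\<close> (via \<open>e\<close>) is an arbitrary compact metrizable topology with
  points in \<open>nat \<Rightarrow> real\<close>.  This loses no generality: every compact metrizable space is
  homeomorphic to a subspace of the Hilbert cube.
\<close>

definition admissible_topology :: "'a topology \<Rightarrow> 'a set topology \<Rightarrow> bool" where
  "admissible_topology X \<T> \<longleftrightarrow>
     (\<exists>(Y :: (nat \<Rightarrow> real) topology) e.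
        compact_space Y \<and> metrizable_space Y \<and> embedding_map X Y e \<and>
        \<T> = pullback_topology (closed_subsets X) (\<lambda>F. Y closure_of (e ` F)) (vietoris Y))"

text \<open>
  Hardness of the family of zero-dimensional closed subsets of \<open>X\<close>, when the hyperspace of closed
  subsets carries the topology \<open>\<T>\<close>; \<open>\<Gamma>\<close> is the trace of the class on the Cantor space.
\<close>

definition zero_dim_hard ::
  "((nat \<Rightarrow> bool) set \<Rightarrow> bool) \<Rightarrow> 'a topology \<Rightarrow> 'a set topology \<Rightarrow> bool" where
  "zero_dim_hard \<Gamma> X \<T> \<longleftrightarrow>
     (\<forall>A. \<Gamma> A \<longrightarrow> (\<exists>\<phi>. continuous_map euclidean \<T> \<phi> \<and> A = \<phi> -` zero_dim_closed_subsets X))"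

end

(*
  A partition in 2^omega x [0,1] between the bottom and the top edge behaves like a strategy: above
  each y it selects some t, continuously in y.  So let y encode the moves of Player II (as an
  increasing set of tokens), let t encode the moves of Player I (by nested intervals), and let X
  consist of the pairs (y, t) that Player I has not won, together with all pairs whose t is an end
  point of an interval.  A winning strategy of Player I yields continuous functions of y with values
  in any prescribed interval whose graphs avoid X, so the slice of X is zero-dimensional.  Here
  Player I needs a fresh start in every interval, hence finitely many restarts are allowed.
  Conversely, a clopen set of the slice that separates bottom from top misses no end point, so above
  any y it singles out a child of every interval it already separates; Player I plays along these
  children.  Since infinitely many restarts lose, there is a reachable position after which no
  restart ever occurs, and from there on this is a winning strategy.  No determinacy is needed.

  A payoff set in Sigma_xi is pulled back from one complete set by a Lipschitz map; each token carries
  one claimed bit of the image, and the points y whose claims are correct for the parameter z form a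
  closed set H_z.  Adding to H_z countably many points with finitely many tokens, which depend on the
  compactification, makes z |-> cl(X restricted to H_z) continuous without affecting its dimension.
*)
theory Submission
  imports Defs
begin

subsection \<open>Sequence spaces\<close>

text \<open>Player II is coded by a set of tokens because she must be allowed to stop answering:
  every finite set is a point, and a token can be added arbitrarily late without disturbing an open
  condition already secured. Player I wins when she stops, which forces a partition to yield a next
  move, and also when an answer claims a move that was not made, so only faithful answers matter.
  Restarts and tags belong together. A selection must exist inside every interval, whatever moves
  its word already codes; the restart letter wipes these moves, and the tags make all earlier tokens
  void for the new game. X may not depend on z, so z enters only through the truth of the claimed
  bits. Bit i depends on the first i coordinates alone, hence each token can be checked when it is
  issued. The bound \<open>\<xi> \<ge> 3\<close> leaves room to remove a Sigma_2 set (end points,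
  too many restarts, too few moves) from a Sigma_xi set within the class. Inside the strip, the
  closure of the part of X over H_z is H_z x [0,1], as end points are dense; the added points serve
  the other compactifications.\<close>

definition agree :: "nat \<Rightarrow> (nat \<Rightarrow> 'b) \<Rightarrow> (nat \<Rightarrow> 'b) \<Rightarrow> bool" where
  "agree n x y \<longleftrightarrow> (\<forall>i<n. x i = y i)"

lemma agree_refl [simp]: "agree n x x"
  and agree_sym: "agree n x y \<Longrightarrow> agree n y x"
  and agree_trans: "agree n x y \<Longrightarrow> agree n y z \<Longrightarrow> agree n x z"
  and agree_mono: "agree n x y \<Longrightarrow> m \<le> n \<Longrightarrow> agree m x y"
  by (auto simp: agree_def)

lemma open_agree: "open {y :: nat \<Rightarrow> 'b::discrete_topology. agree n x y}"
proof -
  have "open {y :: nat \<Rightarrow> 'b. y i = x i}" for i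
  proof -
    have "open ((\<lambda>y :: nat \<Rightarrow> 'b. y i) -` {x i})"
      by (intro open_vimage open_discrete continuous_on_product_coordinates)
    then show ?thesis by (simp add: vimage_def)
  qed
  then have "open (\<Inter>i\<in>{..<n}. {y :: nat \<Rightarrow> 'b. y i = x i})"
    by (intro open_INT) auto
  also have "(\<Inter>i\<in>{..<n}. {y :: nat \<Rightarrow> 'b. y i = x i}) = {y. agree n x y}"
    by (auto simp: agree_def)
  finally show ?thesis .
qed

lemma open_imp_agree:
  fixes U :: "(nat \<Rightarrow> 'b::discrete_topology) set"
  assumes "open U" "x \<in> U"
  obtains n where "\<And>y. agree n x y \<Longrightarrow> y \<in> U"
proof -
  have "openin (product_topology (\<lambda>i. euclidean) UNIV) U"
    using assms by (simp add: open_fun_def)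
  from product_topology_open_contains_basis[OF this \<open>x \<in> U\<close>]
  obtain X where X: "x \<in> (\<Pi>\<^sub>E i\<in>UNIV. X i)" "finite {i. X i \<noteq> UNIV}" "(\<Pi>\<^sub>E i\<in>UNIV. X i) \<subseteq> U"
    by auto
  then obtain n where n: "\<And>i. X i \<noteq> UNIV \<Longrightarrow> i < n"
    by (metis (mono_tags, lifting) finite_nat_set_iff_bounded mem_Collect_eq)
  have "y \<in> U" if "agree n x y" for y
  proof -
    have "y i \<in> X i" for i
    proof (cases "i < n")
      case True
      then have "y i = x i" using that by (simp add: agree_def)
      then show ?thesis using X(1) by (auto simp: PiE_def)
    qed (use n in auto)
    then show ?thesis using X(3) by (auto simp: PiE_def)
  qed
  then show thesis by (rule that)
qed

lemma open_seq_iff: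
  fixes U :: "(nat \<Rightarrow> 'b::discrete_topology) set"
  shows "open U \<longleftrightarrow> (\<forall>x\<in>U. \<exists>n. \<forall>y. agree n x y \<longrightarrow> y \<in> U)"
proof
  show "\<forall>x\<in>U. \<exists>n. \<forall>y. agree n x y \<longrightarrow> y \<in> U" if "open U"
    using open_imp_agree[OF that] by metis
  assume *: "\<forall>x\<in>U. \<exists>n. \<forall>y. agree n x y \<longrightarrow> y \<in> U"
  show "open U"
    unfolding open_subopen[of U]
  proof
    fix x assume "x \<in> U"
    with * obtain n where "\<forall>y. agree n x y \<longrightarrow> y \<in> U" by auto
    then show "\<exists>T. open T \<and> x \<in> T \<and> T \<subseteq> U"
      using open_agree[of n x] by (intro exI[of _ "{y. agree n x y}"]) auto
  qed
qed

lemma open_seq_prod_iff: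
  fixes U :: "((nat \<Rightarrow> 'b::discrete_topology) \<times> (nat \<Rightarrow> 'c::discrete_topology)) set"
  shows "open U \<longleftrightarrow> (\<forall>(x, x')\<in>U. \<exists>n. \<forall>y y'. agree n x y \<longrightarrow> agree n x' y' \<longrightarrow> (y, y') \<in> U)"
proof (safe)
  fix x x' assume "open U" "(x, x') \<in> U"
  then obtain A B where AB: "open A" "open B" "x \<in> A" "x' \<in> B" "A \<times> B \<subseteq> U"
    by (metis open_prod_elim mem_Sigma_iff)
  obtain m where m: "\<And>y. agree m x y \<Longrightarrow> y \<in> A" using open_imp_agree AB by blast
  obtain n where n: "\<And>y. agree n x' y \<Longrightarrow> y \<in> B" using open_imp_agree AB by blast
  show "\<exists>n. \<forall>y y'. agree n x y \<longrightarrow> agree n x' y' \<longrightarrow> (y, y') \<in> U"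
  proof (intro exI[of _ "max m n"] allI impI)
    fix y y' assume "agree (max m n) x y" "agree (max m n) x' y'"
    then show "(y, y') \<in> U" using m n AB(5) by (auto dest!: agree_mono[where m=m] agree_mono[where m=n] simp: agree_def)
  qed
next
  assume *: "Ball U (\<lambda>(x, x'). \<exists>n. \<forall>y y'. agree n x y \<longrightarrow> agree n x' y' \<longrightarrow> (y, y') \<in> U)"
  show "open U"
    unfolding open_subopen[of U]
  proof (clarify)
    fix x x' assume "(x, x') \<in> U"
    with * obtain n where "\<forall>y y'. agree n x y \<longrightarrow> agree n x' y' \<longrightarrow> (y, y') \<in> U" by auto
    then show "\<exists>T. open T \<and> (x, x') \<in> T \<and> T \<subseteq> U"
      by (intro exI[of _ "{y. agree n x y} \<times> {y. agree n x' y}"]) (auto intro!: open_Times open_agree)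
  qed
qed

section \<open>Dyadic neighbourhoods in the product of Cantor space and the line\<close>

definition near :: "nat \<Rightarrow> (nat \<Rightarrow> bool) \<times> real \<Rightarrow> (nat \<Rightarrow> bool) \<times> real \<Rightarrow> bool" where
  "near n p q \<longleftrightarrow> agree n (fst p) (fst q) \<and> \<bar>snd p - snd q\<bar> < 1 / 2 ^ n"

lemma near_refl [simp]: "near n p p"
  and near_sym: "near n p q \<Longrightarrow> near n q p"
  by (auto simp: near_def dest: agree_sym)

lemma near_mono: "near n p q \<Longrightarrow> m \<le> n \<Longrightarrow> near m p q"
proof -
  assume "near n p q" "m \<le> n"
  moreover have "1 / 2 ^ n \<le> (1 / 2 ^ m :: real)" using \<open>m \<le> n\<close>
    by (simp add: field_simps power_increasing)
  ultimately show ?thesis by (auto simp: near_def intro: agree_mono)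
qed

lemma near_triangle: "near (Suc n) p q \<Longrightarrow> near (Suc n) q r \<Longrightarrow> near n p r"
proof -
  assume *: "near (Suc n) p q" "near (Suc n) q r"
  then have "agree n (fst p) (fst q)" "agree n (fst q) (fst r)"
    by (auto simp: near_def elim: agree_mono)
  moreover have "\<bar>snd p - snd r\<bar> < 1 / 2 ^ Suc n + 1 / 2 ^ Suc n"
    using * unfolding near_def by linarith
  ultimately show ?thesis by (auto simp: near_def intro: agree_trans)
qed

lemma open_near: "open {q. near n p q}"
proof -
  have "{q. near n p q} = {y. agree n (fst p) y} \<times> {t. \<bar>snd p - t\<bar> < 1 / 2 ^ n}"
    by (auto simp: near_def)
  moreover have "open {t. \<bar>snd p - t\<bar> < 1 / 2 ^ n}"
    by (intro open_Collect_less continuous_intros)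
  ultimately show ?thesis by (auto intro!: open_Times open_agree)
qed

lemma exists_half_power_less:
  assumes "0 < (e::real)" obtains n where "1 / 2 ^ n < e" "m \<le> (n::nat)"
proof -
  obtain k where "(1/2::real) ^ k < e" using real_arch_pow_inv[OF assms, of "1/2"] by auto
  moreover have "(1/2::real) ^ max k m \<le> (1/2) ^ k" by (intro power_decreasing) auto
  ultimately show thesis by (intro that[of "max k m"]) (auto simp: power_divide)
qed

lemma open_near_iff: "open U \<longleftrightarrow> (\<forall>p\<in>U. \<exists>n. \<forall>q. near n p q \<longrightarrow> q \<in> U)"
proof (intro iffI ballI)
  fix p assume "open U" "p \<in> U"
  then obtain A B where AB: "open A" "open B" "fst p \<in> A" "snd p \<in> B" "A \<times> B \<subseteq> U"
    by (metis open_prod_elim mem_Sigma_iff prod.collapse)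
  obtain m where m: "\<And>y. agree m (fst p) y \<Longrightarrow> y \<in> A" using open_imp_agree AB by blast
  obtain e where e: "e > 0" "\<And>t. \<bar>t - snd p\<bar> < e \<Longrightarrow> t \<in> B"
    using AB by (metis open_dist dist_real_def)
  obtain n where n: "1 / 2 ^ n < e" "m \<le> n" using exists_half_power_less[OF e(1)] by blast
  show "\<exists>n. \<forall>q. near n p q \<longrightarrow> q \<in> U"
  proof (intro exI[of _ n] allI impI)
    fix q assume "near n p q"
    then have "fst q \<in> A" "snd q \<in> B"
      using m e n by (auto simp: near_def abs_minus_commute intro: agree_mono)
    then show "q \<in> U" using AB(5) by (metis mem_Sigma_iff prod.collapse subsetD)
  qed
next
  assume *: "\<forall>p\<in>U. \<exists>n. \<forall>q. near n p q \<longrightarrow> q \<in> U"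
  show "open U"
    unfolding open_subopen[of U]
  proof
    fix p assume "p \<in> U"
    with * obtain n where "\<forall>q. near n p q \<longrightarrow> q \<in> U" by auto
    then show "\<exists>T. open T \<and> p \<in> T \<and> T \<subseteq> U"
      using open_near[of n p] by (intro exI[of _ "{q. near n p q}"]) auto
  qed
qed

lemma open_vimage_fst_agree:
  assumes "\<And>y. P y \<Longrightarrow> \<exists>n. \<forall>y'. agree n y y' \<longrightarrow> P y'"
  shows "open {p :: (nat \<Rightarrow> bool) \<times> real. P (fst p)}"
  unfolding open_near_iff using assms by (fastforce simp: near_def)

subsection \<open>Additive Borel classes\<close>

abbreviation strip :: "((nat \<Rightarrow> bool) \<times> real) set" where
  "strip \<equiv> UNIV \<times> {0..1}"

abbreviation strip_top :: "((nat \<Rightarrow> bool) \<times> real) topology" where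
  "strip_top \<equiv> top_of_set strip"

text \<open>Open sets of a metrizable space are F_sigma: exhaust \<open>U\<close> by the points
  whose \<open>near n\<close> ball stays inside \<open>O'\<close>. This puts rank 1 below the higher
  ranks.\<close>

lemma open_strip_eq_Union_closed:
  assumes "openin strip_top U"
  shows "\<exists>V :: nat \<Rightarrow> _. (\<forall>n. openin strip_top (V n)) \<and> U = (\<Union>n. strip - V n)"
proof -
  obtain O' where O: "open O'" "U = strip \<inter> O'" using assms by (auto simp: openin_open)
  define V where "V n = strip \<inter> {p. \<exists>q. near n p q \<and> q \<notin> O'}" for n
  have "open {p. \<exists>q. near n p q \<and> q \<notin> O'}" for n
  proof -
    have "{p. \<exists>q. near n p q \<and> q \<notin> O'} = (\<Union>q\<in>- O'. {p. near n q p})"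
      by (auto dest: near_sym)
    then show ?thesis by (auto intro: open_near)
  qed
  then have "openin strip_top (V n)" for n
    unfolding V_def by (auto simp: openin_open)
  moreover have "U = (\<Union>n. strip - V n)"
  proof
    show "U \<subseteq> (\<Union>n. strip - V n)"
      using O open_near_iff[of O'] unfolding V_def by blast
    show "(\<Union>n. strip - V n) \<subseteq> U" using O unfolding V_def by force
  qed
  ultimately show ?thesis by blast
qed

context
  fixes r :: "'o rel"
  assumes wo: "Well_order r"
begin

interpretation W: wo_rel r
  using wo by (simp add: wo_rel_def)

lemma underS_trans: "x \<in> underS r y \<Longrightarrow> y \<in> underS r z \<Longrightarrow> x \<in> underS r z"
  using W.TRANS W.ANTISYM unfolding underS_def trans_def antisym_def by blast

lemma underS_linear:
  assumes "x \<in> Field r" "y \<in> Field r"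
  shows "x \<in> underS r y \<or> x = y \<or> y \<in> underS r x"
  using assms W.TOTALS unfolding underS_def by blast

lemma sigma0_not_empty_underS: "underS r \<xi> = {} \<Longrightarrow> \<not> sigma0 r T \<xi> A"
  by (auto elim!: sigma0.cases)

lemma underS_empty_if_card_1: "card (underS r \<xi>) = 1 \<Longrightarrow> \<eta> \<in> underS r \<xi> \<Longrightarrow> underS r \<eta> = {}"
  using underS_trans underS_notIn by (metis card_1_singletonE ex_in_conv singletonD)

text \<open>A union of complements cannot have rank 1: the sets involved would have rank 0, where no
  sets exist.\<close>

lemma sigma0_one:
  assumes "card (underS r \<xi>) = 1" "sigma0 r T \<xi> A" shows "openin T A"
  using assms(2)
proof cases
  case (sigma0_Union \<eta> B)
  then show ?thesis using underS_empty_if_card_1[OF assms(1)] sigma0_not_empty_underS by metis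
qed

lemma sigma0_not_one:
  assumes "card (underS r \<xi>) \<noteq> 1" "sigma0 r T \<xi> A"
  obtains \<eta> B where "\<And>n::nat. \<eta> n \<in> underS r \<xi>" "\<And>n. sigma0 r T (\<eta> n) (B n)"
    "A = (\<Union>n. topspace T - B n)"
  using assms(2)
proof cases
  case (sigma0_Union \<eta> B)
  then show thesis by (intro that) auto
qed (use assms(1) in simp)

text \<open>A presentation as a union of complements stays valid when \<open>\<xi>\<close> replaces
  \<open>\<eta>\<close>. Rank 1 has no such presentation; there the F_sigma form of open sets
  supplies one.\<close>

lemma sigma0_mono:
  assumes A: "sigma0 r strip_top \<eta> A" and lt: "\<eta> \<in> underS r \<xi>"
  shows "sigma0 r strip_top \<xi> A"
proof (cases "card (underS r \<eta>) = 1")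
  case True
  then have "openin strip_top A" using A by (rule sigma0_one)
  from open_strip_eq_Union_closed[OF this] obtain V where
    V: "\<And>n::nat. openin strip_top (V n)" "A = (\<Union>n. topspace strip_top - V n)" by auto
  show ?thesis unfolding V(2)
    by (rule sigma0.sigma0_Union[where \<eta>="\<lambda>_. \<eta>"]) (use lt sigma0_open[OF True V(1)] in blast)
next
  case False
  from sigma0_not_one[OF False A] obtain \<eta>' B where
    B: "\<And>n::nat. \<eta>' n \<in> underS r \<eta>" "\<And>n. sigma0 r strip_top (\<eta>' n) (B n)"
      "A = (\<Union>n. topspace strip_top - B n)" by blast
  show ?thesis unfolding B(3)
    by (rule sigma0.sigma0_Union[where \<eta>=\<eta>']) (use underS_trans[OF B(1) lt] B(2) in blast)
qed

lemma sigma0_UN: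
  assumes A: "\<And>n::nat. sigma0 r T \<xi> (A n)"
  shows "sigma0 r (T :: 'a topology) \<xi> (\<Union>n. A n)"
proof (cases "card (underS r \<xi>) = 1")
  case True
  have "openin T (A n)" for n by (rule sigma0_one[OF True A])
  then have "openin T (\<Union>n. A n)" by (intro openin_Union) auto
  then show ?thesis using True by (intro sigma0_open)
next
  case False
  have "\<exists>f :: nat \<Rightarrow> 'o \<times> 'a set. (\<forall>k. fst (f k) \<in> underS r \<xi> \<and> sigma0 r T (fst (f k)) (snd (f k)))
    \<and> A n = (\<Union>k. topspace T - snd (f k))" for n
  proof (rule sigma0_not_one[OF False A[of n]])
    fix \<eta> :: "nat \<Rightarrow> 'o" and B
    assume "\<And>k. \<eta> k \<in> underS r \<xi>" "\<And>k. sigma0 r T (\<eta> k) (B k)" "A n = (\<Union>k. topspace T - B k)"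
    then show ?thesis by (intro exI[of _ "\<lambda>k. (\<eta> k, B k)"]) simp
  qed
  from choice[OF allI, OF this] obtain f :: "nat \<Rightarrow> nat \<Rightarrow> 'o \<times> 'a set" where
    f: "\<forall>n. (\<forall>k. fst (f n k) \<in> underS r \<xi> \<and> sigma0 r T (fst (f n k)) (snd (f n k)))
      \<and> A n = (\<Union>k. topspace T - snd (f n k))" ..
  define \<eta> B where "\<eta> n k = fst (f n k)" and "B n k = snd (f n k)" for n k
  have B: "\<eta> n k \<in> underS r \<xi> \<and> sigma0 r T (\<eta> n k) (B n k)" "A n = (\<Union>k. topspace T - B n k)" for n k
    using conjunct1[OF spec[OF f, of n], THEN spec, of k] conjunct2[OF spec[OF f, of n]]
    unfolding \<eta>_def B_def .
  have "(\<Union>n. A n) = (\<Union>i. topspace T - (case prod_decode i of (n, k) \<Rightarrow> B n k))"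
  proof -
    have "x \<in> (\<Union>n. A n) \<longleftrightarrow> x \<in> (\<Union>i. topspace T - (case prod_decode i of (n, k) \<Rightarrow> B n k))" for x
    proof
      assume "x \<in> (\<Union>n. A n)"
      then obtain n where "x \<in> A n" by blast
      then have "x \<in> (\<Union>k. topspace T - B n k)" by (simp only: B(2))
      then obtain k where "x \<in> topspace T - B n k" by blast
      then show "x \<in> (\<Union>i. topspace T - (case prod_decode i of (n, k) \<Rightarrow> B n k))"
        by (intro UN_I[of "prod_encode (n, k)"]) (simp_all only: prod_encode_inverse prod.case UNIV_I)
    next
      assume "x \<in> (\<Union>i. topspace T - (case prod_decode i of (n, k) \<Rightarrow> B n k))"
      then obtain i where i: "x \<in> topspace T - (case prod_decode i of (n, k) \<Rightarrow> B n k)" by (rule UN_E)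
      obtain n k where nk: "prod_decode i = (n, k)" by (cases "prod_decode i")
      then have "x \<in> topspace T - B n k" using i by (simp only: prod.case nk)
      then have "x \<in> (\<Union>k. topspace T - B n k)" by blast
      then have "x \<in> A n" by (simp only: B(2))
      then show "x \<in> (\<Union>n. A n)" by blast
    qed
    then show ?thesis by (rule set_eqI)
  qed
  moreover have "sigma0 r T \<xi> (\<Union>i. topspace T - (case prod_decode i of (n, k) \<Rightarrow> B n k))"
    by (rule sigma0.sigma0_Union[where \<eta>="\<lambda>i. case prod_decode i of (n, k) \<Rightarrow> \<eta> n k"])
      (simp add: B(1) split: prod.split)
  ultimately show ?thesis by simp
qed

lemma sigma0_Un:
  assumes "sigma0 r T \<xi> A" "sigma0 r T \<xi> B"
  shows "sigma0 r T \<xi> (A \<union> B)"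
proof -
  have "sigma0 r T \<xi> (\<Union>n. if n = (0::nat) then A else B)"
    using assms by (intro sigma0_UN) auto
  moreover have "(\<Union>n. if n = (0::nat) then A else B) = A \<union> B"
  proof
    show "(\<Union>n. if n = (0::nat) then A else B) \<subseteq> A \<union> B" by (auto split: if_splits)
    show "A \<union> B \<subseteq> (\<Union>n. if n = (0::nat) then A else B)"
      using UN_upper[of "0::nat" UNIV "\<lambda>n. if n = (0::nat) then A else B"]
        UN_upper[of "1::nat" UNIV "\<lambda>n. if n = (0::nat) then A else B"] by simp
  qed
  ultimately show ?thesis by simp
qed

lemma exists_card_underS:
  assumes "rank_ge r \<xi> (Suc n)" "\<xi> \<in> Field r"
  shows "\<exists>\<eta>\<in>underS r \<xi>. finite (underS r \<eta>) \<and> card (underS r \<eta>) = n"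
  using assms(1)
proof (induction n)
  case 0
  then have ne: "underS r \<xi> \<noteq> {}" by (auto simp: rank_ge_def)
  have sub: "underS r \<xi> \<subseteq> Field r" by (auto dest: underS_Field)
  define m where "m = W.minim (underS r \<xi>)"
  have m: "m \<in> underS r \<xi>" using W.minim_in[OF sub ne] by (simp add: m_def)
  have "underS r m = {}"
  proof (rule ccontr)
    assume "underS r m \<noteq> {}"
    then obtain x where x: "x \<in> underS r m" by auto
    from underS_trans[OF this m] have "x \<in> underS r \<xi>" .
    then have "(m, x) \<in> r" using W.minim_least[OF sub] by (simp add: m_def)
    then show False using x antisymD[OF W.ANTISYM] by (auto simp: underS_def)
  qed
  then show ?case using m by (intro bexI[of _ m]) simp_all
next
  case (Suc n)
  then have "rank_ge r \<xi> (Suc n)" by (auto simp: rank_ge_def)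
  with Suc.IH obtain \<eta> where \<eta>: "\<eta> \<in> underS r \<xi>" "finite (underS r \<eta>)" "card (underS r \<eta>) = n" by auto
  \<comment> \<open>The next element in the order is the least one outside the closed initial
    segment \<open>K\<close> of \<open>\<eta>\<close>; its strict predecessors are exactly
    \<open>K\<close>.\<close>
  define K where "K = insert \<eta> (underS r \<eta>)"
  have K: "finite K" "card K = Suc n" using \<eta> underS_notIn[of \<eta> r] by (auto simp: K_def)
  have ne: "underS r \<xi> - K \<noteq> {}"
  proof
    assume "underS r \<xi> - K = {}"
    then have "underS r \<xi> \<subseteq> K" by blast
    then have "finite (underS r \<xi>)" "card (underS r \<xi>) \<le> Suc n"
      using K card_mono[OF K(1), of "underS r \<xi>"] finite_subset[OF _ K(1), of "underS r \<xi>"] by simp_all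
    then show False using Suc.prems by (auto simp: rank_ge_def)
  qed
  have sub: "underS r \<xi> - K \<subseteq> Field r" by (auto dest: underS_Field)
  define m where "m = W.minim (underS r \<xi> - K)"
  have m: "m \<in> underS r \<xi>" "m \<notin> K" using W.minim_in[OF sub ne] by (auto simp: m_def)
  have "underS r m = K"
  proof
    show "underS r m \<subseteq> K"
    proof
      fix x assume x: "x \<in> underS r m"
      show "x \<in> K"
      proof (rule ccontr)
        assume "x \<notin> K"
        moreover have "x \<in> underS r \<xi>" by (rule underS_trans[OF x m(1)])
        ultimately have "(m, x) \<in> r" using W.minim_least[OF sub] by (simp add: m_def)
        then show False using x antisymD[OF W.ANTISYM] by (auto simp: underS_def)
      qed
    qed
    have "\<eta> \<in> Field r" "m \<in> Field r" using \<eta>(1) m(1) by (auto dest: underS_Field)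
    then have "\<eta> \<in> underS r m" using underS_linear[of \<eta> m] m(2) by (auto simp: K_def)
    then show "K \<subseteq> underS r m" using underS_trans[of _ \<eta> m] by (auto simp: K_def)
  qed
  then show ?case using m K by (intro bexI[of _ m]) simp_all
qed

lemma exists_rank_one_below:
  assumes "\<xi> \<in> Field r" "underS r \<xi> \<noteq> {}" "card (underS r \<xi>) \<noteq> 1"
  obtains \<eta> where "\<eta> \<in> underS r \<xi>" "card (underS r \<eta>) = 1"
proof -
  have "rank_ge r \<xi> (Suc 1)"
  proof (cases "finite (underS r \<xi>)")
    case True
    then have "card (underS r \<xi>) \<noteq> 0" using assms by auto
    then have "2 \<le> card (underS r \<xi>)" using assms by linarith
    then show ?thesis by (simp add: rank_ge_def)
  qed (simp add: rank_ge_def)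
  from exists_card_underS[OF this assms(1)] show thesis using that by auto
qed

text \<open>\<open>A - B\<close> is the union of the complements of \<open>C n \<union> B\<close>.
  Each such set has the larger of the two ranks, which is still below \<open>\<xi>\<close> because
  rank 2 is.\<close>

lemma sigma0_Diff_sigma0_two:
  assumes \<xi>: "\<xi> \<in> Field r" and A: "sigma0 r strip_top \<xi> A"
    and two: "two \<in> underS r \<xi>" "card (underS r two) = 2"
    and B: "sigma0 r strip_top two B"
  shows "sigma0 r strip_top \<xi> (A - B)"
proof -
  have "finite (underS r two)" using two(2) card.infinite by fastforce
  have n1: "card (underS r \<xi>) \<noteq> 1"
  proof
    assume "card (underS r \<xi>) = 1"
    from underS_empty_if_card_1[OF this two(1)] show False using two(2) by simp
  qed
  from sigma0_not_one[OF n1 A] obtain \<eta> C where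
    C: "\<And>n::nat. \<eta> n \<in> underS r \<xi>" "\<And>n. sigma0 r strip_top (\<eta> n) (C n)"
      "A = (\<Union>n. strip - C n)" by auto
  have "\<exists>\<zeta>\<in>underS r \<xi>. sigma0 r strip_top \<zeta> (C n \<union> B)" for n
  proof -
    have "\<eta> n \<in> Field r" "two \<in> Field r" using C(1)[of n] two(1) by (auto dest: underS_Field)
    from underS_linear[OF this] show ?thesis
    proof (elim disjE)
      assume "\<eta> n \<in> underS r two"
      from sigma0_Un[OF sigma0_mono[OF C(2) this] B] show ?thesis using two(1) by blast
    next
      assume "\<eta> n = two"
      then have "sigma0 r strip_top two (C n)" using C(2)[of n] by simp
      from sigma0_Un[OF this B] show ?thesis using two(1) by blast
    next
      assume "two \<in> underS r (\<eta> n)"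
      from sigma0_Un[OF C(2) sigma0_mono[OF B this]] show ?thesis using C(1) by blast
    qed
  qed
  then have "\<exists>\<zeta>. \<zeta> \<in> underS r \<xi> \<and> sigma0 r strip_top \<zeta> (C n \<union> B)" for n by blast
  from choice[OF allI, OF this] obtain \<zeta> :: "nat \<Rightarrow> 'o" where
    \<zeta>: "\<forall>n. \<zeta> n \<in> underS r \<xi> \<and> sigma0 r strip_top (\<zeta> n) (C n \<union> B)" ..
  have "sigma0 r strip_top \<xi> (\<Union>n. topspace strip_top - (C n \<union> B))"
    by (rule sigma0.sigma0_Union[where \<eta>=\<zeta>]) (use \<zeta> in simp)
  moreover have "(\<Union>n. topspace strip_top - (C n \<union> B)) = A - B" using C(3) by auto
  ultimately show ?thesis by simp
qed

end

subsection \<open>Complete sets of the Borel classes\<close>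

text \<open>Only the first component of the decoded index selects a rank, so for countable
  \<open>underS r \<xi>\<close> each rank from 1 on recurs infinitely often, and the second
  component is free to number the sets of that rank.\<close>

definition pred_enum :: "'o rel \<Rightarrow> 'o \<Rightarrow> nat \<Rightarrow> 'o" where
  "pred_enum r \<xi> n = from_nat_into {\<eta> \<in> underS r \<xi>. underS r \<eta> \<noteq> {}} (fst (prod_decode n))"

text \<open>The standard Sigma_xi-complete set: \<open>x\<close> is read as a matrix, and some row
  must miss the complete set of its own rank.\<close>

definition complete_set :: "'o rel \<Rightarrow> 'o \<Rightarrow> (nat \<Rightarrow> bool) set" where
  "complete_set r = wfrec (r - Id) (\<lambda>f \<xi>.
     if card (underS r \<xi>) = 1 then {x. \<exists>n. x n}
     else {x. \<exists>n. (\<lambda>k. x (prod_encode (n, k))) \<notin> f (pred_enum r \<xi> n)})"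

text \<open>Strict form: coordinate \<open>i\<close> sees only coordinates below \<open>i\<close>.
  The bit claimed in round \<open>i\<close> can thus be computed from the earlier rounds.\<close>

definition lipschitz_game :: "((nat \<Rightarrow> bool) \<Rightarrow> (nat \<Rightarrow> nat) \<Rightarrow> nat \<Rightarrow> bool) \<Rightarrow> bool" where
  "lipschitz_game F \<longleftrightarrow> (\<forall>z z' \<gamma> \<gamma>' i. agree i z z' \<longrightarrow> agree i \<gamma> \<gamma>' \<longrightarrow> F z \<gamma> i = F z' \<gamma>' i)"

context
  fixes r :: "'o rel"
  assumes wo: "Well_order r"
begin

lemma pred_enum_in:
  assumes "\<xi> \<in> Field r" "underS r \<xi> \<noteq> {}" "card (underS r \<xi>) \<noteq> 1"
  shows "pred_enum r \<xi> n \<in> underS r \<xi>" "underS r (pred_enum r \<xi> n) \<noteq> {}"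
proof -
  obtain \<eta> where \<eta>: "\<eta> \<in> underS r \<xi>" "card (underS r \<eta>) = 1"
    using exists_rank_one_below[OF wo assms] .
  have "underS r \<eta> \<noteq> {}" using \<eta>(2) by (metis card.empty zero_neq_one)
  then have ne: "{\<eta> \<in> underS r \<xi>. underS r \<eta> \<noteq> {}} \<noteq> {}" using \<eta>(1) by blast
  from from_nat_into[OF this, of "fst (prod_decode n)"]
  show "pred_enum r \<xi> n \<in> underS r \<xi>" "underS r (pred_enum r \<xi> n) \<noteq> {}"
    unfolding pred_enum_def by simp_all
qed

lemma complete_set_one: "card (underS r \<xi>) = 1 \<Longrightarrow> complete_set r \<xi> = {x. \<exists>n. x n}"
  using def_wfrec[OF eq_reflection[OF complete_set_def] wo_rel.WF, of r \<xi>] wo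
  by (simp add: wo_rel_def)

lemma complete_set_step:
  assumes "\<xi> \<in> Field r" "underS r \<xi> \<noteq> {}" "card (underS r \<xi>) \<noteq> 1"
  shows "complete_set r \<xi> =
    {x. \<exists>n. (\<lambda>k. x (prod_encode (n, k))) \<notin> complete_set r (pred_enum r \<xi> n)}"
proof -
  have "(pred_enum r \<xi> n, \<xi>) \<in> r - Id" for n
    using pred_enum_in(1)[OF assms, of n] by (simp add: underS_def)
  then show ?thesis
    using def_wfrec[OF eq_reflection[OF complete_set_def] wo_rel.WF, of r \<xi>] wo assms(3)
    by (simp add: wo_rel_def cut_apply)
qed

lemma underS_induct [consumes 1, case_names less]:
  assumes "\<xi> \<in> Field r"
    and step: "\<And>\<xi>. \<xi> \<in> Field r \<Longrightarrow> (\<And>\<eta>. \<eta> \<in> underS r \<xi> \<Longrightarrow> P \<eta>) \<Longrightarrow> P \<xi>"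
  shows "P \<xi>"
proof -
  have "wf (r - Id)" using wo by (simp add: wo_rel.WF wo_rel_def)
  then have "\<xi> \<in> Field r \<longrightarrow> P \<xi>"
  proof (induction \<xi>)
    case (less \<xi>)
    show ?case
    proof
      assume "\<xi> \<in> Field r"
      then show "P \<xi>"
      proof (rule step)
        fix \<eta> assume \<eta>: "\<eta> \<in> underS r \<xi>"
        then have "(\<eta>, \<xi>) \<in> r - Id" "\<eta> \<in> Field r" by (auto simp: underS_def Field_def)
        then show "P \<eta>" using less by blast
      qed
    qed
  qed
  then show ?thesis using assms(1) by blast
qed

lemma sigma0_topspace:
  assumes "\<xi> \<in> Field r" "underS r \<xi> \<noteq> {}"
  shows "sigma0 r T \<xi> (topspace T)"
proof (cases "card (underS r \<xi>) = 1")
  case True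
  then show ?thesis by (intro sigma0_open) auto
next
  case False
  obtain \<eta> where \<eta>: "\<eta> \<in> underS r \<xi>" "card (underS r \<eta>) = 1"
    using exists_rank_one_below[OF wo assms False] .
  have "sigma0 r T \<xi> (\<Union>n::nat. topspace T - {})"
    by (rule sigma0.sigma0_Union[where \<eta>="\<lambda>_. \<eta>"]) (use \<eta>(1) sigma0_open[OF \<eta>(2) openin_empty] in blast)
  then show ?thesis by simp
qed

text \<open>Induction on the rank. The reductions of the rows are merged by the pairing function;
  the Lipschitz property survives because a position inside a row never exceeds its code.\<close>

lemma sigma0_complete_set_reduction:
  assumes "\<xi> \<in> Field r" "countable (underS r \<xi>)"
    and "sigma0 r (euclidean :: ((nat \<Rightarrow> bool) \<times> (nat \<Rightarrow> nat)) topology) \<xi> B"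
  shows "\<exists>F. lipschitz_game F \<and> (\<forall>z \<gamma>. (z, \<gamma>) \<in> B \<longleftrightarrow> F z \<gamma> \<in> complete_set r \<xi>)"
  using assms
proof (induction arbitrary: B rule: underS_induct)
  case (less \<xi>)
  have ne: "underS r \<xi> \<noteq> {}"
    using sigma0_not_empty_underS[OF wo] less.prems(2) by blast
  show ?case
  proof (cases "card (underS r \<xi>) = 1")
    case True
    then have "open B" using sigma0_one[OF wo True less.prems(2)] by simp
    \<comment> \<open>Stage \<open>n\<close> tests whether the cylinder of length \<open>n\<close>
      lies in the open set, which reads just \<open>n\<close> coordinates.\<close>
    define F where "F z \<gamma> n \<longleftrightarrow> (\<forall>z' \<gamma>'. agree n z z' \<longrightarrow> agree n \<gamma> \<gamma>' \<longrightarrow> (z', \<gamma>') \<in> B)" for z \<gamma> n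
    have "F z \<gamma> i = F z' \<gamma>' i" if "agree i z z'" "agree i \<gamma> \<gamma>'" for z z' \<gamma> \<gamma>' i
      unfolding F_def using that agree_trans agree_sym by metis
    then have "lipschitz_game F" unfolding lipschitz_game_def by blast
    moreover have "(z, \<gamma>) \<in> B \<longleftrightarrow> F z \<gamma> \<in> complete_set r \<xi>" for z \<gamma>
    proof -
      have "(z, \<gamma>) \<in> B \<longleftrightarrow> (\<exists>n. F z \<gamma> n)"
        using \<open>open B\<close> unfolding open_seq_prod_iff F_def by fastforce
      then show ?thesis by (simp add: complete_set_one[OF True])
    qed
    ultimately show ?thesis by blast
  next
    case False
    obtain \<eta> C where
      C: "\<And>n::nat. \<eta> n \<in> underS r \<xi>" "\<And>n. sigma0 r euclidean (\<eta> n) (C n)"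
        "B = (\<Union>n. topspace euclidean - C n)"
      using sigma0_not_one[OF wo False less.prems(2)] by metis
    let ?e = "pred_enum r \<xi>"
    \<comment> \<open>Rows whose rank does not fit are padded with the whole space, whose complement
      adds nothing to the union.\<close>
    define E where "E n = (if \<eta> (snd (prod_decode n)) = ?e n then C (snd (prod_decode n)) else UNIV)" for n
    have e: "?e n \<in> underS r \<xi>" "underS r (?e n) \<noteq> {}" "?e n \<in> Field r" for n
      using pred_enum_in[OF less.hyps ne False] underS_Field by metis+
    have "sigma0 r euclidean (?e n) (E n)" for n
      using sigma0_topspace[OF e(3)[of n] e(2)[of n], where T = euclidean] C(2)[of "snd (prod_decode n)"]
      by (auto simp: E_def)
    moreover have "countable (underS r (?e n))" for n
      by (rule countable_subset[OF _ less.prems(1)]) (use underS_trans[OF wo _ e(1)] in blast)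
    ultimately have "\<exists>F. lipschitz_game F \<and> (\<forall>z \<gamma>. (z, \<gamma>) \<in> E n \<longleftrightarrow> F z \<gamma> \<in> complete_set r (?e n))" for n
      using less.IH[OF e(1)] by blast
    from choice[OF allI, OF this] obtain F where
      F: "\<forall>n. lipschitz_game (F n) \<and> (\<forall>z \<gamma>. (z, \<gamma>) \<in> E n \<longleftrightarrow> F n z \<gamma> \<in> complete_set r (?e n))" ..
    define G where "G z \<gamma> j = F (fst (prod_decode j)) z \<gamma> (snd (prod_decode j))" for z \<gamma> j
    have "lipschitz_game G"
      unfolding lipschitz_game_def
    proof (intro allI impI)
      fix z z' :: "nat \<Rightarrow> bool" and \<gamma> \<gamma>' :: "nat \<Rightarrow> nat" and j
      assume *: "agree j z z'" "agree j \<gamma> \<gamma>'"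
      have le: "snd (prod_decode j) \<le> j"
        using le_prod_encode_2[of "snd (prod_decode j)" "fst (prod_decode j)"] by simp
      have "lipschitz_game (F (fst (prod_decode j)))" using F by blast
      then show "G z \<gamma> j = G z' \<gamma>' j"
        unfolding G_def lipschitz_game_def using agree_mono[OF *(1) le] agree_mono[OF *(2) le] by blast
    qed
    moreover have "(z, \<gamma>) \<in> B \<longleftrightarrow> G z \<gamma> \<in> complete_set r \<xi>" for z \<gamma>
    proof -
      have "(z, \<gamma>) \<in> B \<longleftrightarrow> (\<exists>n. (z, \<gamma>) \<notin> E n)"
      proof
        assume "(z, \<gamma>) \<in> B"
        then obtain b where b: "(z, \<gamma>) \<notin> C b" using C(3) by blast
        let ?P = "{\<eta> \<in> underS r \<xi>. underS r \<eta> \<noteq> {}}"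
        have P: "countable ?P" by (rule countable_subset[OF _ less.prems(1)]) blast
        have "underS r (\<eta> b) \<noteq> {}" using sigma0_not_empty_underS[OF wo] C(2)[of b] by blast
        then have "\<eta> b \<in> ?P" using C(1) by blast
        \<comment> \<open>The row in which \<open>C b\<close> is filed: the first component encodes
          its rank, the second is \<open>b\<close> itself.\<close>
        from from_nat_into_to_nat_on[OF P this]
        have "?e (prod_encode (to_nat_on ?P (\<eta> b), b)) = \<eta> b" by (simp add: pred_enum_def)
        then have "E (prod_encode (to_nat_on ?P (\<eta> b), b)) = C b" by (simp add: E_def)
        then show "\<exists>n. (z, \<gamma>) \<notin> E n" using b by blast
      next
        assume "\<exists>n. (z, \<gamma>) \<notin> E n"
        then show "(z, \<gamma>) \<in> B" unfolding E_def C(3) by (auto split: if_splits)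
      qed
      also have "\<dots> \<longleftrightarrow> (\<exists>n. F n z \<gamma> \<notin> complete_set r (?e n))" using F by simp
      also have "\<dots> \<longleftrightarrow> G z \<gamma> \<in> complete_set r \<xi>"
        by (simp add: complete_set_step[OF less.hyps ne False] G_def)
      finally show ?thesis .
    qed
    ultimately show ?thesis by blast
  qed
qed

text \<open>It suffices that truth of a coordinate is open, since rank 1 asks for one true
  coordinate and the higher ranks are built from it. Labels need this generality: a missing label
  reads as false, and a later token may make it true.\<close>

lemma sigma0_vimage_complete_set:
  assumes "\<xi> \<in> Field r" "underS r \<xi> \<noteq> {}"
    and L: "\<And>i. openin T {p \<in> topspace T. L p i}"
  shows "sigma0 r T \<xi> {p \<in> topspace T. L p \<in> complete_set r \<xi>}"
  using assms
proof (induction arbitrary: L rule: underS_induct)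
  case (less \<xi>)
  show ?case
  proof (cases "card (underS r \<xi>) = 1")
    case True
    have "{p \<in> topspace T. L p \<in> complete_set r \<xi>} = (\<Union>i. {p \<in> topspace T. L p i})"
      by (auto simp: complete_set_one[OF True])
    moreover have "openin T (\<Union>i. {p \<in> topspace T. L p i})"
      using less.prems(2) by (intro openin_Union) auto
    ultimately show ?thesis using sigma0_open[OF True] by simp
  next
    case False
    let ?e = "pred_enum r \<xi>"
    define B where "B n = {p \<in> topspace T. (\<lambda>k. L p (prod_encode (n, k))) \<in> complete_set r (?e n)}" for n
    have e: "?e n \<in> underS r \<xi>" "underS r (?e n) \<noteq> {}" for n
      using pred_enum_in[OF less.hyps less.prems(1) False] by simp_all
    have "sigma0 r T (?e n) (B n)" for n
      unfolding B_def by (rule less.IH[OF e(1) e(2)]) (rule less.prems(2))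
    then have "sigma0 r T \<xi> (\<Union>n. topspace T - B n)"
      using e(1) by (intro sigma0.sigma0_Union[where \<eta>="?e"]) simp
    moreover have "(\<Union>n. topspace T - B n) = {p \<in> topspace T. L p \<in> complete_set r \<xi>}"
      by (auto simp: B_def complete_set_step[OF less.hyps less.prems(1) False])
    ultimately show ?thesis by simp
  qed
qed

end

subsection \<open>Nested intervals, tokens and the set X\<close>

text \<open>
  Words over \<open>nat\<close> index nested intervals: the children of an interval are adjacent and accumulate
  only at its right end point.
\<close>

definition cut :: "nat list \<Rightarrow> real \<times> real" where
  "cut = foldl (\<lambda>(a, l) n. (a + l * (1 - 1 / 2 ^ n), l / 2 ^ Suc n)) (0, 1)"

definition lo :: "nat list \<Rightarrow> real" where "lo u = fst (cut u)"
definition len :: "nat list \<Rightarrow> real" where "len u = snd (cut u)"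
definition hi :: "nat list \<Rightarrow> real" where "hi u = lo u + len u"

definition inI :: "real \<Rightarrow> nat list \<Rightarrow> bool" where
  "inI t u \<longleftrightarrow> lo u < t \<and> t < hi u"

definition cuts :: "real set" where
  "cuts = range lo \<union> range hi"

lemma lo_Nil [simp]: "lo [] = 0" and len_Nil [simp]: "len [] = 1" and hi_Nil [simp]: "hi [] = 1"
  by (simp_all add: lo_def len_def hi_def cut_def)

lemma lo_snoc: "lo (u @ [n]) = lo u + len u * (1 - 1 / 2 ^ n)"
  and len_snoc: "len (u @ [n]) = len u / 2 ^ Suc n"
  by (simp_all add: lo_def len_def cut_def case_prod_beta)

text \<open>Adjacency of siblings. A right end point other than 1 is thereby also a left end point,
  so arguments about end points can concentrate on \<open>lo\<close>.\<close>

lemma hi_snoc: "hi (u @ [n]) = lo (u @ [Suc n])"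
  by (simp add: hi_def lo_snoc len_snoc field_simps)

lemma lo_snoc_0: "lo (u @ [0]) = lo u"
  by (simp add: lo_snoc)

lemma len_pos: "0 < len u"
  by (induction u rule: rev_induct) (simp_all add: len_snoc)

lemma len_le: "len u \<le> 1 / 2 ^ length u"
proof (induction u rule: rev_induct)
  case (snoc n u)
  have "len (u @ [n]) \<le> len u / 2"
    unfolding len_snoc using len_pos[of u] by (intro divide_left_mono) auto
  then show ?case using snoc by simp
qed simp

lemma lo_less_hi: "lo u < hi u"
  using len_pos[of u] by (simp add: hi_def)

lemma hi_minus_lo_le: "hi u - lo u \<le> 1 / 2 ^ length u"
  using len_le[of u] by (simp add: hi_def)

lemma lo_snoc_ge: "lo u \<le> lo (u @ [n])"
  using len_pos[of u] by (simp add: lo_snoc)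

lemma lo_snoc_gr: "0 < n \<Longrightarrow> lo u < lo (u @ [n])"
  using len_pos[of u] one_less_power[of "2::real" n] by (simp add: lo_snoc)

lemma hi_snoc_less: "hi (u @ [n]) < hi u"
  using len_pos[of u] unfolding hi_snoc by (simp add: lo_snoc hi_def algebra_simps)

lemma lo_append: "lo u \<le> lo (u @ v)"
proof (induction v rule: rev_induct)
  case (snoc n v)
  then show ?case using lo_snoc_ge[of "u @ v" n] by simp
qed simp

lemma hi_append: "hi (u @ v) \<le> hi u"
proof (induction v rule: rev_induct)
  case (snoc n v)
  then show ?case using hi_snoc_less[of "u @ v" n] by simp
qed simp

lemma lo_ge_0: "0 \<le> lo u" and hi_le_1: "hi u \<le> 1"
  using lo_append[of "[]" u] hi_append[of "[]" u] by simp_all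

lemma inI_append: "inI t (u @ v) \<Longrightarrow> inI t u"
  using lo_append[of u v] hi_append[of u v] by (simp add: inI_def)

lemma lo_hi_in_cuts: "lo u \<in> cuts" "hi u \<in> cuts"
  by (auto simp: cuts_def)

lemma countable_cuts: "countable cuts"
  by (simp add: cuts_def)

lemma cuts_subset: "cuts \<subseteq> {0..1}"
proof
  fix t assume "t \<in> cuts"
  then obtain u where "t = lo u \<or> t = hi u" by (auto simp: cuts_def)
  then show "t \<in> {0..1}" using lo_ge_0[of u] hi_le_1[of u] lo_less_hi[of u] by auto
qed

lemma lo_snoc_mono: "m \<le> n \<Longrightarrow> lo (u @ [m]) \<le> lo (u @ [n])"
  using len_pos[of u] by (simp add: lo_snoc power_increasing frac_le)

lemma lo_snoc_tendsto: "(\<lambda>n. lo (u @ [n])) \<longlonglongrightarrow> hi u"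
proof -
  have "(\<lambda>n. lo u + len u * (1 - (1 / 2) ^ n)) \<longlonglongrightarrow> lo u + len u * (1 - 0)"
    by (intro tendsto_intros LIMSEQ_power_zero) simp
  then show ?thesis by (simp add: lo_snoc hi_def power_divide)
qed

lemma inI_Nil: "inI t [] \<longleftrightarrow> 0 < t \<and> t < 1"
  by (simp add: inI_def)

lemma inI_snoc:
  assumes "inI t u" "t \<notin> cuts" obtains n where "inI t (u @ [n])"
proof -
  have "eventually (\<lambda>n. t < lo (u @ [n])) sequentially"
    using order_tendstoD(1)[OF lo_snoc_tendsto] assms(1) by (simp add: inI_def)
  then obtain N where "t < lo (u @ [N])" by (auto simp: eventually_sequentially)
  \<comment> \<open>The wanted child precedes the first left end point beyond \<open>t\<close>;
    equality with its own left end is excluded because \<open>t\<close> is no cut.\<close>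
  define n where "n = (LEAST n. t < lo (u @ [n]))"
  have n: "t < lo (u @ [n])" unfolding n_def by (rule LeastI) fact
  moreover have "n \<noteq> 0" using n assms(1) by (auto simp: inI_def lo_snoc_0 intro: ccontr)
  then obtain m where m: "n = Suc m" using not0_implies_Suc by blast
  have "\<not> t < lo (u @ [m])" using not_less_Least[of m "\<lambda>n. t < lo (u @ [n])"] m unfolding n_def by simp
  moreover have "t \<noteq> lo (u @ [m])" using assms(2) lo_hi_in_cuts by blast
  ultimately have "inI t (u @ [m])" using n m by (simp add: inI_def hi_snoc)
  then show thesis by (rule that)
qed

lemma inI_word:
  assumes "t \<in> {0..1}" "t \<notin> cuts" obtains u where "inI t u" "length u = k"
proof (induction k arbitrary: thesis)
  case 0
  have "t \<noteq> 0" "t \<noteq> 1" using assms(2) lo_hi_in_cuts[of "[]"] by auto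
  then show ?case using assms(1) by (intro 0[of "[]"]) (auto simp: inI_Nil)
next
  case (Suc k)
  obtain u where "inI t u" "length u = k" using Suc.IH by blast
  then show ?case using inI_snoc[OF _ assms(2)] Suc.prems by (metis length_append_singleton)
qed

lemma inI_snoc_unique:
  assumes "inI t (u @ [m])" "inI t (u @ [n])" shows "m = n"
proof -
  have "\<not> m < n" if "inI t (u @ [m])" "inI t (u @ [n])" for m n
    using that lo_snoc_mono[of "Suc m" n u] by (auto simp: inI_def hi_snoc)
  then show ?thesis using assms by (meson linorder_neqE_nat)
qed

lemma inI_prefix:
  assumes "inI t u" "inI t v" "length u \<le> length v" shows "\<exists>w. v = u @ w"
  using assms(1,3)
proof (induction u rule: rev_induct)
  case (snoc n u)
  then obtain w where w: "v = u @ w" using inI_append[of t u "[n]"] by auto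
  then obtain m w' where mw: "w = m # w'" using snoc.prems by (cases w) auto
  then have "inI t (u @ [m])" using assms(2) w inI_append[of t "u @ [m]" w'] by simp
  from inI_snoc_unique[OF this snoc.prems(1)] show ?case using w mw by simp
qed simp

text \<open>A point outside the countable set \<open>cuts\<close> lies inside intervals of every
  level, and their lengths tend to 0.\<close>

lemma exists_inI_subset:
  assumes "0 \<le> a" "a < b" "b \<le> 1" obtains u where "a < lo u" "hi u < b"
proof -
  have "uncountable ({a<..<b} - cuts)"
    using assms(2) by (intro uncountable_minus_countable uncountable_open_interval[THEN iffD2] countable_cuts)
  then obtain t where t: "t \<in> {a<..<b}" "t \<notin> cuts"
    using countable_empty by (metis DiffE equals0I)
  obtain k where k: "1 / 2 ^ k < min (t - a) (b - t)"
    using exists_half_power_less[of "min (t - a) (b - t)"] t(1) by auto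
  obtain u where u: "inI t u" "length u = k" using inI_word[of t] t assms by auto
  then show thesis using k hi_minus_lo_le[of u] by (intro that[of u]) (auto simp: inI_def)
qed

text \<open>The inequalities are weak because the limit may be an end point, for instance when all
  added letters are 0.\<close>

lemma nested_words_limit:
  assumes ext: "\<And>k. \<exists>w. u (Suc k) = u k @ w"
  obtains t where "\<And>k. lo (u k) \<le> t" "\<And>k. t \<le> hi (u k)"
proof -
  have ext': "\<exists>w. u (k + j) = u k @ w" for k j
  proof (induction j)
    case (Suc j)
    then obtain w where "u (k + j) = u k @ w" ..
    moreover obtain w' where "u (Suc (k + j)) = u (k + j) @ w'" using ext by blast
    ultimately show ?case by (intro exI[of _ "w @ w'"]) simp
  qed simp
  have le: "lo (u j) \<le> hi (u k)" for j k
  proof (cases "j \<le> k")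
    case True
    then obtain w where "u k = u j @ w" using ext'[of j "k - j"] by auto
    then show ?thesis using lo_append[of "u j" w] lo_less_hi[of "u k"] by simp
  next
    case False
    then obtain w where "u j = u k @ w" using ext'[of k "j - k"] by auto
    then show ?thesis using hi_append[of "u k" w] lo_less_hi[of "u j"] by simp
  qed
  have bdd: "bdd_above (range (\<lambda>j. lo (u j)))" by (rule bdd_aboveI2[of _ _ "hi (u 0)"]) (rule le)
  show thesis
  proof (rule that[of "SUP j. lo (u j)"])
    show "lo (u k) \<le> (SUP j. lo (u j))" for k by (rule cSUP_upper[OF _ bdd]) simp
    show "(SUP j. lo (u j)) \<le> hi (u k)" for k by (rule cSUP_least) (use le in auto)
  qed
qed

text \<open>
  A letter of a word is a move of Player I: letters below 2 mean waiting, 2 restarts the game, and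
  \<open>n + 3\<close> is the genuine move \<open>n\<close>.  The state records the number of restarts and the genuine moves
  since the last one.
\<close>

definition step :: "nat \<times> nat list \<Rightarrow> nat \<Rightarrow> nat \<times> nat list" where
  "step s d = (if d < 2 then s else if d = 2 then (Suc (fst s), []) else (fst s, snd s @ [d - 3]))"

definition restarts :: "nat list \<Rightarrow> nat" where "restarts u = fst (foldl step (0, []) u)"
definition moves :: "nat list \<Rightarrow> nat list" where "moves u = snd (foldl step (0, []) u)"

lemma restarts_Nil [simp]: "restarts [] = 0" and moves_Nil [simp]: "moves [] = []"
  by (simp_all add: restarts_def moves_def)

lemma restarts_snoc: "restarts (u @ [d]) = (if d = 2 then Suc (restarts u) else restarts u)"
  and moves_snoc: "moves (u @ [d]) =
    (if d < 2 then moves u else if d = 2 then [] else moves u @ [d - 3])"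
  by (simp_all add: restarts_def moves_def step_def)

lemma restarts_append: "restarts u \<le> restarts (u @ v)"
proof (induction v rule: rev_induct)
  case (snoc d v)
  then show ?case using restarts_snoc[of "u @ v" d] by simp
qed simp

lemma moves_append:
  assumes "restarts (u @ v) = restarts u" shows "\<exists>l. moves (u @ v) = moves u @ l"
  using assms
proof (induction v rule: rev_induct)
  case (snoc d v)
  have "restarts (u @ v) = restarts u" "d \<noteq> 2"
    using snoc.prems restarts_append[of u v] restarts_snoc[of "u @ v" d] by (auto split: if_splits)
  then show ?case using snoc.IH moves_snoc[of "u @ v" d] by auto
qed simp

lemma restarts_le_length: "restarts u \<le> length u"
  by (induction u rule: rev_induct) (auto simp: restarts_snoc)

lemma length_moves_le: "length (moves u) \<le> length u"
  by (induction u rule: rev_induct) (auto simp: moves_snoc)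

text \<open>
  A point \<open>y\<close> of the Cantor space is a set of tokens.  A token carries the number of restarts after
  which Player II issues it, the move of Player I it answers, the answer, and a claimed payoff bit.
\<close>

definition token :: "nat \<Rightarrow> (nat \<times> nat \<times> nat \<times> bool) \<times> nat" where "token = from_nat"
definition tag :: "nat \<Rightarrow> nat" where "tag p = fst (fst (token p))"
definition claim :: "nat \<Rightarrow> nat" where "claim p = fst (snd (fst (token p)))"
definition reply :: "nat \<Rightarrow> nat" where "reply p = fst (snd (snd (fst (token p))))"
definition bit :: "nat \<Rightarrow> bool" where "bit p = snd (snd (snd (fst (token p))))"

text \<open>The last component of a token is a free serial number. Because of it every content
  recurs arbitrarily late, so a reply can be issued after any finite stage.\<close>

lemma exists_token: "\<exists>p\<ge>N. tag p = R \<and> claim p = m \<and> reply p = n \<and> bit p = b"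
proof -
  have "inj (\<lambda>i::nat. to_nat ((R, m, n, b), i))" by (auto intro: injI)
  then have "infinite (range (\<lambda>i::nat. to_nat ((R, m, n, b), i)))" by (rule range_inj_infinite)
  then obtain i where "N \<le> to_nat ((R, m, n, b), i :: nat)"
    unfolding infinite_nat_iff_unbounded_le by blast
  then show ?thesis
    by (intro exI[of _ "to_nat ((R, m, n, b), i)"])
      (simp add: tag_def claim_def reply_def bit_def token_def)
qed

text \<open>The entry at index \<open>i\<close> answers round \<open>i\<close> of the game after
  \<open>R\<close> restarts; increasing position is the order of issue.\<close>

definition toks :: "nat \<Rightarrow> (nat \<Rightarrow> bool) \<Rightarrow> nat \<Rightarrow> nat list" where
  "toks R y k = filter (\<lambda>p. y p \<and> tag p = R) [0..<k]"

lemma toks_0 [simp]: "toks R y 0 = []"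
  and toks_Suc: "toks R y (Suc k) = (if y k \<and> tag k = R then toks R y k @ [k] else toks R y k)"
  by (simp_all add: toks_def)

lemma toks_agree: "agree k y y' \<Longrightarrow> toks R y k = toks R y' k"
  unfolding toks_def agree_def by (rule filter_cong) auto

lemma toks_mono: "k \<le> k' \<Longrightarrow> \<exists>l. toks R y k' = toks R y k @ l"
proof (induction k' rule: dec_induct)
  case (step n)
  then show ?case by (auto simp: toks_Suc)
qed simp

lemma length_toks_le: "length (toks R y k) \<le> k"
  unfolding toks_def using length_filter_le[of _ "[0..<k]"] by simp

lemma length_toks_mono: "k \<le> k' \<Longrightarrow> length (toks R y k) \<le> length (toks R y k')"
  using toks_mono[of k k' R y] by auto

lemma toks_nth_eq: "i < length (toks R y k) \<Longrightarrow> i < length (toks R y k') \<Longrightarrow> toks R y k ! i = toks R y k' ! i"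
  using toks_mono[of k k' R y] toks_mono[of k' k R y] by (cases "k \<le> k'") (auto simp: nth_append)

lemma toks_nth_props:
  assumes "i < length (toks R y k)"
  shows "toks R y k ! i < k" "y (toks R y k ! i)" "tag (toks R y k ! i) = R"
    "length (toks R y (toks R y k ! i)) = i"
proof -
  have "toks R y k ! i \<in> set (toks R y k)" using assms by simp
  then show "toks R y k ! i < k" "y (toks R y k ! i)" "tag (toks R y k ! i) = R"
    by (auto simp: toks_def)
  show "length (toks R y (toks R y k ! i)) = i"
    using assms
  proof (induction k)
    case (Suc k)
    then show ?case by (auto simp: toks_Suc nth_append less_Suc_eq split: if_splits)
  qed simp
qed

definition label :: "nat \<Rightarrow> (nat \<Rightarrow> bool) \<Rightarrow> nat \<Rightarrow> bool" where
  "label R y i \<longleftrightarrow> (\<exists>p. y p \<and> tag p = R \<and> length (toks R y p) = i \<and> bit p)"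

lemma label_nth:
  assumes "i < length (toks R y k)" shows "label R y i \<longleftrightarrow> bit (toks R y k ! i)"
proof
  assume "label R y i"
  then obtain p where p: "y p" "tag p = R" "length (toks R y p) = i" "bit p"
    by (auto simp: label_def)
  have "toks R y (Suc p) ! i = p" using p by (simp add: toks_Suc nth_append)
  moreover have "i < length (toks R y (Suc p))" using p by (simp add: toks_Suc)
  ultimately show "bit (toks R y k ! i)" using toks_nth_eq[OF assms] p(4) by metis
qed (use toks_nth_props[OF assms] in \<open>auto simp: label_def\<close>)

text \<open>
  Player I wins \<open>(y, t)\<close> if \<open>t\<close> is not an end point, contains only finitely many restarts and, after
  the last one, more moves than \<open>y\<close> has answers; if \<open>y\<close> has infinitely many answers, then moreover
  they must answer other moves than those of \<open>t\<close>, or the claimed bits must lie in \<open>S\<close>.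
\<close>

definition won :: "(nat \<Rightarrow> bool) set \<Rightarrow> (nat \<Rightarrow> bool) \<Rightarrow> real \<Rightarrow> bool" where
  "won S y t \<longleftrightarrow> t \<notin> cuts \<and> (\<exists>R. (\<forall>u. inI t u \<longrightarrow> restarts u \<le> R) \<and>
     (\<forall>k. \<exists>u. inI t u \<and> restarts u = R \<and> length (toks R y k) < length (moves u)) \<and>
     ((\<exists>k. \<forall>k'. length (toks R y k') \<le> k) \<or>
      (\<exists>u i k. inI t u \<and> restarts u = R \<and> i < length (moves u) \<and> i < length (toks R y k) \<and>
         moves u ! i \<noteq> claim (toks R y k ! i)) \<or>
      label R y \<in> S))"

definition arena :: "(nat \<Rightarrow> bool) set \<Rightarrow> ((nat \<Rightarrow> bool) \<times> real) set" where
  "arena S = {p \<in> strip. \<not> won S (fst p) (snd p)}"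

lemma open_inI: "open {p :: (nat \<Rightarrow> bool) \<times> real. inI (snd p) u}"
  unfolding inI_def by (intro open_Collect_conj open_Collect_less continuous_intros)

lemma open_toks: "open {p :: (nat \<Rightarrow> bool) \<times> real. P (toks R (fst p) k)}"
proof (rule open_vimage_fst_agree)
  fix y assume "P (toks R y k)"
  then have "\<forall>y'. agree k y y' \<longrightarrow> P (toks R y' k)" using toks_agree by metis
  then show "\<exists>n. \<forall>y'. agree n y y' \<longrightarrow> P (toks R y' k)" ..
qed

lemma openin_stripI: "open U \<Longrightarrow> openin strip_top {p \<in> strip. p \<in> U}"
  by (auto simp: openin_open intro!: exI[of _ U])

text \<open>For a fixed number \<open>R\<close> of restarts, \<open>P R\<close> collects the Sigma_2
  ways to fail (end point, too many restarts, too few moves) and \<open>Q R\<close> is the Sigma_xi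
  payoff disjunction; Player I wins on the union of the differences
  \<open>Q R - P R\<close>.\<close>

lemma pi0_arena:
  fixes r :: "'o rel"
  assumes wo: "Well_order r" and \<xi>: "\<xi> \<in> Field r" "rank_ge r \<xi> 3"
  shows "pi0 r strip_top \<xi> (arena (complete_set r \<xi>))"
proof -
  have "rank_ge r \<xi> (Suc 2)" using \<xi>(2) by (simp add: eval_nat_numeral)
  from exists_card_underS[OF wo this \<xi>(1)] obtain two where
    two: "two \<in> underS r \<xi>" "finite (underS r two)" "card (underS r two) = 2" by blast
  have F2: "two \<in> Field r" using two(1) by (rule underS_Field)
  have "underS r two \<noteq> {}" "card (underS r two) \<noteq> 1" using two(3) by auto
  from exists_rank_one_below[OF wo F2 this] obtain one where
    one: "one \<in> underS r two" "card (underS r one) = 1" .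
  let ?\<Sigma>2 = "sigma0 r strip_top two" and ?\<Sigma> = "sigma0 r strip_top \<xi>"
  have closed2: "?\<Sigma>2 (\<Union>n::nat. strip - V n)" if "\<And>n. openin strip_top (V n)" for V
  proof -
    have "?\<Sigma>2 (\<Union>n::nat. topspace strip_top - V n)"
      by (rule sigma0.sigma0_Union[where \<eta>="\<lambda>_. one"])
        (use one(1) sigma0_open[OF one(2) that] in blast)
    then show ?thesis by simp
  qed
  have open2: "?\<Sigma>2 U" if "openin strip_top U" for U
    using sigma0_mono[OF wo sigma0_open[OF one(2) that] one(1)] .
  have ne: "underS r \<xi> \<noteq> {}" using two(1) by blast
  let ?S = "complete_set r \<xi>"
  define P where "P R = {p \<in> strip. snd p \<in> cuts} \<union> {p \<in> strip. \<exists>u. inI (snd p) u \<and> R < restarts u}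
    \<union> {p \<in> strip. \<exists>k. \<forall>u. \<not> (inI (snd p) u \<and> restarts u = R \<and> length (toks R (fst p) k) < length (moves u))}"
    for R
  define Q where "Q R = {p \<in> strip. \<exists>k. \<forall>k'. length (toks R (fst p) k') \<le> k}
    \<union> {p \<in> strip. \<exists>u i k. inI (snd p) u \<and> restarts u = R \<and> i < length (moves u) \<and>
         i < length (toks R (fst p) k) \<and> moves u ! i \<noteq> claim (toks R (fst p) k ! i)}
    \<union> {p \<in> strip. label R (fst p) \<in> ?S}" for R
  have "?\<Sigma>2 {p \<in> strip. snd p \<in> cuts}"
  proof -
    have "openin strip_top {p \<in> strip. p \<in> {p. snd p \<noteq> from_nat_into cuts n}}" for n
      by (intro openin_stripI open_Collect_neq continuous_intros)
    from closed2[OF this] have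
      "?\<Sigma>2 (\<Union>n. strip - {p \<in> strip. p \<in> {p. snd p \<noteq> from_nat_into cuts n}})" .
    also have "(\<Union>n. strip - {p \<in> strip. p \<in> {p. snd p \<noteq> from_nat_into cuts n}}) =
        {p \<in> strip. snd p \<in> range (from_nat_into cuts)}" by auto
    also have "range (from_nat_into cuts) = cuts"
      using lo_hi_in_cuts countable_cuts by (intro range_from_nat_into) auto
    finally show ?thesis .
  qed
  moreover have "?\<Sigma>2 {p \<in> strip. \<exists>u. inI (snd p) u \<and> R < restarts u}" for R
  proof -
    have "openin strip_top {p \<in> strip. p \<in> {p. \<exists>u. inI (snd p) u \<and> R < restarts u}}"
      by (intro openin_stripI open_Collect_ex open_Collect_conj open_inI open_Collect_const)
    then show ?thesis using open2 by simp
  qed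
  moreover have "?\<Sigma>2 {p \<in> strip. \<exists>k. \<forall>u. \<not> (inI (snd p) u \<and> restarts u = R \<and>
      length (toks R (fst p) k) < length (moves u))}" for R
  proof -
    define V where "V k = {p \<in> strip. p \<in> {p. \<exists>u. inI (snd p) u \<and> restarts u = R \<and>
      length (toks R (fst p) k) < length (moves u)}}" for k
    have "openin strip_top (V k)" for k
      unfolding V_def
      by (intro openin_stripI open_Collect_ex open_Collect_conj open_inI open_Collect_const)
        (rule open_toks)
    from closed2[of V, OF this] show ?thesis
      by (rule back_subst[where P = ?\<Sigma>2]) (auto simp: V_def)
  qed
  ultimately have P: "?\<Sigma>2 (P R)" for R
    unfolding P_def by (intro sigma0_Un[OF wo])
  have "?\<Sigma>2 {p \<in> strip. \<exists>k. \<forall>k'. length (toks R (fst p) k') \<le> k}" for R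
  proof -
    define V where "V k = {p \<in> strip. p \<in> {p. \<exists>k'. \<not> length (toks R (fst p) k') \<le> k}}" for k
    have "openin strip_top (V k)" for k
      unfolding V_def by (intro openin_stripI open_Collect_ex) (rule open_toks)
    from closed2[of V, OF this] show ?thesis
      by (rule back_subst[where P = ?\<Sigma>2]) (auto simp: V_def)
  qed
  moreover have "?\<Sigma>2 {p \<in> strip. \<exists>u i k. inI (snd p) u \<and> restarts u = R \<and> i < length (moves u) \<and>
         i < length (toks R (fst p) k) \<and> moves u ! i \<noteq> claim (toks R (fst p) k ! i)}" for R
  proof -
    have "openin strip_top {p \<in> strip. p \<in> {p. \<exists>u i k. inI (snd p) u \<and> restarts u = R \<and>
      i < length (moves u) \<and> i < length (toks R (fst p) k) \<and> moves u ! i \<noteq> claim (toks R (fst p) k ! i)}}"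
      by (intro openin_stripI open_Collect_ex open_Collect_conj open_inI open_Collect_const)
        (rule open_toks)+
    then show ?thesis using open2 by simp
  qed
  moreover have "?\<Sigma> {p \<in> strip. label R (fst p) \<in> ?S}" for R
  proof -
    have "openin strip_top {p \<in> strip. p \<in> {p. label R (fst p) i}}" for i
    proof (intro openin_stripI open_vimage_fst_agree)
      fix y assume "label R y i"
      then obtain p where p: "y p" "tag p = R" "length (toks R y p) = i" "bit p"
        by (auto simp: label_def)
      have "label R y' i" if "agree (Suc p) y y'" for y'
        using p that toks_agree[OF agree_mono[OF that], of p R]
        by (auto simp: label_def agree_def intro!: exI[of _ p])
      then show "\<exists>n. \<forall>y'. agree n y y' \<longrightarrow> label R y' i" by blast
    qed
    then have "openin strip_top {p \<in> topspace strip_top. label R (fst p) i}" for i by simp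
    from sigma0_vimage_complete_set[OF wo \<xi>(1) ne this] show ?thesis by simp
  qed
  ultimately have Q: "?\<Sigma> (Q R)" for R
    unfolding Q_def using sigma0_mono[OF wo _ two(1)] by (intro sigma0_Un[OF wo]) auto
  have "?\<Sigma> (\<Union>R. Q R - P R)"
    by (rule sigma0_UN[OF wo]) (rule sigma0_Diff_sigma0_two[OF wo \<xi>(1) Q two(1,3) P])
  also have "(\<Union>R. Q R - P R) = {p \<in> strip. won ?S (fst p) (snd p)}"
  proof (rule set_eqI)
    fix p
    have "p \<in> Q R - P R \<longleftrightarrow> p \<in> strip \<and> snd p \<notin> cuts \<and> (\<forall>u. inI (snd p) u \<longrightarrow> restarts u \<le> R) \<and>
     (\<forall>k. \<exists>u. inI (snd p) u \<and> restarts u = R \<and> length (toks R (fst p) k) < length (moves u)) \<and>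
     ((\<exists>k. \<forall>k'. length (toks R (fst p) k') \<le> k) \<or>
      (\<exists>u i k. inI (snd p) u \<and> restarts u = R \<and> i < length (moves u) \<and> i < length (toks R (fst p) k) \<and>
         moves u ! i \<noteq> claim (toks R (fst p) k ! i)) \<or>
      label R (fst p) \<in> ?S)" (is "_ \<longleftrightarrow> ?W R") for R
    proof (cases "p \<in> strip")
      case True
      then have "p \<in> P R \<longleftrightarrow> snd p \<in> cuts \<or> \<not> (\<forall>u. inI (snd p) u \<longrightarrow> restarts u \<le> R) \<or>
          \<not> (\<forall>k. \<exists>u. inI (snd p) u \<and> restarts u = R \<and> length (toks R (fst p) k) < length (moves u))"
        unfolding P_def Un_iff mem_Collect_eq not_less[of R, symmetric] by blast
      moreover have "p \<in> Q R \<longleftrightarrow> (\<exists>k. \<forall>k'. length (toks R (fst p) k') \<le> k) \<or>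
        (\<exists>u i k. inI (snd p) u \<and> restarts u = R \<and> i < length (moves u) \<and> i < length (toks R (fst p) k) \<and>
         moves u ! i \<noteq> claim (toks R (fst p) k ! i)) \<or> label R (fst p) \<in> ?S"
        unfolding Q_def Un_iff mem_Collect_eq using True by (simp only: simp_thms disj_assoc)
      ultimately show ?thesis using True by (simp only: Diff_iff de_Morgan_disj simp_thms conj_ac)
    qed (auto simp: P_def Q_def)
    then have "p \<in> (\<Union>R. Q R - P R) \<longleftrightarrow> (\<exists>R. ?W R)" by (simp only: UN_iff UNIV_I bex_UNIV simp_thms)
    also have "\<dots> \<longleftrightarrow> p \<in> {p \<in> strip. won ?S (fst p) (snd p)}"
      unfolding won_def mem_Collect_eq by (simp only: ex_simps simp_thms)
    finally show "p \<in> (\<Union>R. Q R - P R) \<longleftrightarrow> p \<in> {p \<in> strip. won ?S (fst p) (snd p)}" .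
  qed
  also have "\<dots> = strip - arena ?S" by (auto simp: arena_def)
  finally show ?thesis
    unfolding pi0_def by (auto simp: arena_def)
qed

subsection \<open>From strategies to partitions\<close>

text \<open>Interleaves the claimed moves of Player I with the replies. The bit of round
  \<open>i\<close> reads at most \<open>i\<close> entries, and \<open>2 * i\<close> of them are
  filled by then.\<close>

definition play :: "nat list \<Rightarrow> nat \<Rightarrow> nat" where
  "play ps j = (if j div 2 < length ps
     then (if even j then claim (ps ! (j div 2)) else reply (ps ! (j div 2))) else 0)"

text \<open>Finite approximation of H_z. Checking the tokens below \<open>n\<close> takes only
  \<open>n\<close> coordinates of \<open>y\<close> and of \<open>z\<close>; hence H_z is closed, and
  a change of \<open>z\<close> beyond \<open>n\<close> leaves the approximation intact.\<close>

definition honest ::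
  "((nat \<Rightarrow> bool) \<Rightarrow> (nat \<Rightarrow> nat) \<Rightarrow> nat \<Rightarrow> bool) \<Rightarrow> (nat \<Rightarrow> bool) \<Rightarrow> nat \<Rightarrow> (nat \<Rightarrow> bool) \<Rightarrow> bool" where
  "honest F z n y \<longleftrightarrow>
     (\<forall>p<n. y p \<longrightarrow> bit p = F z (play (toks (tag p) y p)) (length (toks (tag p) y p)))"

lemma honest_mono: "honest F z n y \<Longrightarrow> m \<le> n \<Longrightarrow> honest F z m y"
  by (auto simp: honest_def)

lemma honest_agree:
  assumes F: "lipschitz_game F" and z: "agree n z z'" and y: "agree n y y'" and h: "honest F z n y"
  shows "honest F z' n y'"
  unfolding honest_def
proof (intro allI impI)
  fix p assume p: "p < n" "y' p"
  have yp: "y p" using p y by (simp add: agree_def)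
  have eq: "toks (tag p) y p = toks (tag p) y' p"
    using agree_mono[OF y] p(1) by (intro toks_agree) auto
  let ?i = "length (toks (tag p) y' p)"
  have "agree ?i z z'" using agree_mono[OF z, of ?i] length_toks_le[of "tag p" y' p] p(1) by simp
  then have "F z (play (toks (tag p) y' p)) ?i = F z' (play (toks (tag p) y' p)) ?i"
    using F by (simp add: lipschitz_game_def)
  then show "bit p = F z' (play (toks (tag p) y' p)) ?i"
    using h p(1) yp eq by (auto simp: honest_def)
qed

text \<open>An honest bit of round \<open>i\<close> is computed from the \<open>play\<close> of the
  preceding rounds, which coincides with \<open>\<gamma>\<close> as far as \<open>F\<close>
  looks.\<close>

lemma label_eq_game:
  assumes F: "lipschitz_game F" and hon: "\<And>n. honest F z n y"
    and unb: "\<And>i. \<exists>k. i < length (toks R y k)"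
    and \<gamma>: "\<And>i k. i < length (toks R y k) \<Longrightarrow>
      \<gamma> (2 * i) = claim (toks R y k ! i) \<and> \<gamma> (Suc (2 * i)) = reply (toks R y k ! i)"
  shows "label R y = F z \<gamma>"
proof
  fix i
  obtain k where k: "i < length (toks R y k)" using unb by blast
  define p where "p = toks R y k ! i"
  have p: "y p" "tag p = R" "length (toks R y p) = i"
    using toks_nth_props[OF k] by (simp_all add: p_def)
  have "agree i (play (toks R y p)) \<gamma>"
    unfolding agree_def
  proof (intro allI impI)
    fix j assume "j < i"
    then have j: "j div 2 < length (toks R y p)" using p(3) by auto
    show "play (toks R y p) j = \<gamma> j"
    proof (cases "even j")
      case True
      then have "2 * (j div 2) = j" by simp
      then show ?thesis using \<gamma>[OF j] True j by (simp add: play_def)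
    next
      case False
      then have "Suc (2 * (j div 2)) = j" by simp
      then show ?thesis using \<gamma>[OF j] False j by (simp add: play_def)
    qed
  qed
  then have "F z (play (toks R y p)) i = F z \<gamma> i"
    using F by (simp add: lipschitz_game_def)
  moreover have "label R y i = bit p" using label_nth[OF k] by (simp add: p_def)
  moreover have "bit p = F z (play (toks R y p)) i"
    using hon[of "Suc p"] p by (simp add: honest_def)
  ultimately show "label R y i = F z \<gamma> i" by simp
qed

text \<open>An end point new at some level borders siblings of that level, and deeper intervals lie
  within a single sibling. Consequently a point interior to intervals of every level is no
  cut.\<close>

lemma not_inI_lo_hi:
  assumes "length v \<le> length u" shows "\<not> inI (lo v) u" "\<not> inI (hi v) u"
proof -
  have *: "\<not> inI (lo (v @ [n])) u"
    if v: "\<not> inI (lo v) u" "Suc (length v) \<le> length u" for v n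
  proof
    assume a: "inI (lo (v @ [n])) u"
    have "n \<noteq> 0" using a v(1) lo_snoc_0[of v] by (metis)
    then have "inI (lo (v @ [n])) v"
      using lo_snoc_gr[of n v] lo_less_hi[of "v @ [n]"] hi_snoc_less[of v n] by (simp add: inI_def)
    from inI_prefix[OF this a] v(2) obtain w where w: "u = v @ w" by auto
    then obtain m w' where mw: "w = m # w'" using v(2) by (cases w) auto
    have "inI (lo (v @ [n])) (v @ [m])"
      using a w mw inI_append[of _ "v @ [m]" w'] by simp
    then have "lo (v @ [m]) < lo (v @ [n])" "lo (v @ [n]) < lo (v @ [Suc m])"
      by (simp_all add: inI_def hi_snoc)
    moreover have "n \<le> m \<or> Suc m \<le> n" by auto
    ultimately show False using lo_snoc_mono[of n m v] lo_snoc_mono[of "Suc m" n v] by auto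
  qed
  have lo: "\<not> inI (lo v) u" if "length v \<le> length u" for v
    using that
  proof (induction v rule: rev_induct)
    case Nil
    then show ?case using lo_ge_0[of u] by (simp add: inI_def)
  next
    case (snoc n v)
    then show ?case by (intro *) auto
  qed
  show "\<not> inI (lo v) u" using lo assms by simp
  show "\<not> inI (hi v) u"
  proof (cases v rule: rev_cases)
    case Nil
    then show ?thesis using hi_le_1[of u] by (simp add: inI_def)
  next
    case (snoc v' n)
    then show ?thesis using *[of v' "Suc n"] lo[of v'] assms by (simp add: hi_snoc)
  qed
qed

text \<open>
  Player I opens with a restart inside the interval of \<open>u\<close> and then follows \<open>\<sigma>\<close>, waiting whenever
  the tokens seen so far do not yet answer all moves made.  Waiting is coded by 1 rather than 0, so
  that the left endpoints increase strictly and the limit is not a cut point.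
\<close>

primrec follow :: "(nat list \<Rightarrow> nat) \<Rightarrow> nat list \<Rightarrow> (nat \<Rightarrow> bool) \<Rightarrow> nat \<Rightarrow> nat list" where
  "follow \<sigma> u y 0 = u @ [2]"
| "follow \<sigma> u y (Suc k) = follow \<sigma> u y k @
    [let ms = moves (follow \<sigma> u y k); ps = toks (Suc (restarts u)) y k in
     if length ms \<le> length ps
     then \<sigma> (map (\<lambda>j. if even j then ms ! (j div 2) else reply (ps ! (j div 2))) [0..<2 * length ms]) + 3
     else 1]"

lemma follow_ext: "\<exists>d\<ge>1. follow \<sigma> u y (Suc k) = follow \<sigma> u y k @ [d]"
  by (simp add: Let_def)

lemma length_follow: "length (follow \<sigma> u y k) = Suc (length u + k)"
  by (induction k) simp_all

lemma restarts_follow: "restarts (follow \<sigma> u y k) = Suc (restarts u)"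
  by (induction k) (simp_all add: restarts_snoc Let_def)

lemma follow_agree: "agree k y y' \<Longrightarrow> follow \<sigma> u y k = follow \<sigma> u y' k"
proof (induction k)
  case (Suc k)
  then have "agree k y y'" by (auto intro: agree_mono)
  then show ?case using Suc.IH toks_agree[of k y y'] by (simp add: Let_def)
qed simp

lemma follow_mono: "k \<le> k' \<Longrightarrow> \<exists>w. follow \<sigma> u y k' = follow \<sigma> u y k @ w"
proof (induction k' rule: dec_induct)
  case (step n)
  then show ?case by (auto simp: Let_def)
qed simp

lemma moves_follow_mono: "k \<le> k' \<Longrightarrow> \<exists>l. moves (follow \<sigma> u y k') = moves (follow \<sigma> u y k) @ l"
  using follow_mono[of k k' \<sigma> u y] moves_append restarts_follow by metis

text \<open>Move \<open>i\<close> is issued only once the \<open>i\<close> previous replies are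
  available, and it is computed from them. Both lists only grow, so what held at that stage remains
  true.\<close>

lemma moves_follow:
  assumes "i < length (moves (follow \<sigma> u y k))"
  shows "i \<le> length (toks (Suc (restarts u)) y k) \<and>
    moves (follow \<sigma> u y k) ! i = \<sigma> (map (\<lambda>j. if even j then moves (follow \<sigma> u y k) ! (j div 2)
       else reply (toks (Suc (restarts u)) y k ! (j div 2))) [0..<2 * i])"
  using assms
proof (induction k)
  case 0
  then show ?case by (simp add: moves_snoc)
next
  case (Suc k)
  let ?R = "Suc (restarts u)"
  let ?ms = "moves (follow \<sigma> u y k)" and ?ms' = "moves (follow \<sigma> u y (Suc k))"
  let ?ps = "toks ?R y k" and ?ps' = "toks ?R y (Suc k)"
  let ?p = "\<lambda>ms ps j. if even j then ms ! (j div 2) else reply (ps ! (j div 2))"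
  obtain l where l: "?ps' = ?ps @ l" using toks_mono[of k "Suc k"] by auto
  have *: "map (?p ?ms' ?ps') [0..<2 * i] = map (?p ?ms ?ps) [0..<2 * i]"
    if "i \<le> length ?ms" "i \<le> length ?ps" "?ms' = ?ms @ l'" for l'
  proof (rule map_cong[OF refl])
    fix j assume "j \<in> set [0..<2 * i]"
    then have "j div 2 < i" by auto
    then show "?p ?ms' ?ps' j = ?p ?ms ?ps j" unfolding l that(3) using that(1,2) by (simp add: nth_append)
  qed
  show ?case
  proof (cases "length ?ms \<le> length ?ps")
    case True
    have ms': "?ms' = ?ms @ [\<sigma> (map (?p ?ms ?ps) [0..<2 * length ?ms])]"
      using True by (simp add: Let_def moves_snoc)
    show ?thesis
    proof (cases "i < length ?ms")
      case i: True
      have le: "i \<le> length ?ps" using Suc.IH[OF i] by blast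
      have nth: "?ms' ! i = ?ms ! i" unfolding ms' using i by (simp add: nth_append)
      show ?thesis
        unfolding nth *[OF less_imp_le[OF i] le ms'] using Suc.IH[OF i] l by simp
    next
      case False
      then have i: "i = length ?ms" using Suc.prems unfolding ms' by simp
      have le: "i \<le> length ?ms" "i \<le> length ?ps" using True i by simp_all
      have nth: "?ms' ! i = \<sigma> (map (?p ?ms ?ps) [0..<2 * i])" unfolding ms' i by simp
      show ?thesis unfolding nth *[OF le ms'] using le l by simp
    qed
  next
    case False
    have ms': "?ms' = ?ms @ []" using False by (simp add: Let_def moves_snoc)
    have i: "i < length ?ms" using Suc.prems unfolding ms' by simp
    have le: "i \<le> length ?ps" using Suc.IH[OF i] by blast
    have nth: "?ms' ! i = ?ms ! i" unfolding ms' by simp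
    show ?thesis
      unfolding nth *[OF less_imp_le[OF i] le ms'] using Suc.IH[OF i] l by simp
  qed
qed

text \<open>While the moves do not outnumber the tokens, the next letter is a genuine move. This
  yields the clause of \<open>won\<close> that demands more moves than answers, also when Player II
  falls silent.\<close>

lemma length_moves_follow_unbounded:
  "\<exists>k. length (toks (Suc (restarts u)) y k0) < length (moves (follow \<sigma> u y k))"
proof -
  let ?R = "Suc (restarts u)"
  have "\<exists>k\<ge>k0. c < length (moves (follow \<sigma> u y k))" if "c \<le> length (toks ?R y k0)" for c
    using that
  proof (induction c)
    case 0
    show ?case
    proof (cases "0 < length (moves (follow \<sigma> u y k0))")
      case False
      then have "0 < length (moves (follow \<sigma> u y (Suc k0)))" by (simp add: Let_def moves_snoc)
      then show ?thesis by (intro exI[of _ "Suc k0"]) simp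
    qed auto
  next
    case (Suc c)
    then obtain k where k: "k \<ge> k0" "c < length (moves (follow \<sigma> u y k))" by auto
    show ?case
    proof (cases "Suc c < length (moves (follow \<sigma> u y k))")
      case False
      then have "length (moves (follow \<sigma> u y k)) = Suc c" using k by simp
      moreover have "Suc c \<le> length (toks ?R y k)"
        using Suc.prems length_toks_mono[OF k(1), of ?R y] by simp
      ultimately have "Suc c < length (moves (follow \<sigma> u y (Suc k)))"
        by (simp add: Let_def moves_snoc)
      then show ?thesis using k(1) by (intro exI[of _ "Suc k"]) simp
    qed (use k in auto)
  qed
  then show ?thesis by blast
qed

text \<open>\<open>h y\<close> is the limit of the intervals of \<open>follow\<close>. The word at
  stage \<open>k\<close> depends on \<open>k\<close> coordinates of \<open>y\<close> and has more
  than \<open>k\<close> letters, whence the modulus of continuity. Points with finitely many tokens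
  are won whether honest or not, since their answers are bounded; this keeps the points added later
  harmless.\<close>

lemma winning_strategy_imp_continuous_selection:
  assumes F: "lipschitz_game F"
    and win: "\<And>\<gamma>. (\<And>k. \<gamma> (2 * k) = \<sigma> (map \<gamma> [0..<2 * k])) \<Longrightarrow> F z \<gamma> \<in> S"
  obtains h :: "(nat \<Rightarrow> bool) \<Rightarrow> real"
  where "\<And>y k y'. agree k y y' \<Longrightarrow> \<bar>h y - h y'\<bar> \<le> 1 / 2 ^ k"
    and "\<And>y. lo u < h y \<and> h y < hi u"
    and "\<And>y. (\<forall>n. honest F z n y) \<or> finite {p. y p} \<Longrightarrow> won S y (h y)"
proof -
  let ?w = "follow \<sigma> u"
  let ?R = "Suc (restarts u)"
  have "\<exists>t. \<forall>k. lo (?w y k) \<le> t \<and> t \<le> hi (?w y k)" for y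
    by (rule nested_words_limit[of "?w y"]) (use follow_ext in blast)+
  then obtain h where h: "\<And>y k. lo (?w y k) \<le> h y \<and> h y \<le> hi (?w y k)" by metis
  have inI: "inI (h y) (?w y k)" for y k
  proof -
    obtain d where d: "d \<ge> 1" "?w y (Suc k) = ?w y k @ [d]" using follow_ext by blast
    then show ?thesis
      using h[of y "Suc k"] lo_snoc_gr[of d "?w y k"] hi_snoc_less[of "?w y k" d]
      by (simp add: inI_def)
  qed
  have not_cut: "h y \<notin> cuts" for y
  proof
    assume "h y \<in> cuts"
    then obtain v where "h y = lo v \<or> h y = hi v" by (auto simp: cuts_def)
    moreover have "length v \<le> length (?w y (length v))" by (simp add: length_follow)
    ultimately show False using not_inI_lo_hi[of v "?w y (length v)"] inI[of y "length v"] by auto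
  qed
  show thesis
  proof (rule that)
    show "\<bar>h y - h y'\<bar> \<le> 1 / 2 ^ k" if "agree k y y'" for y k y'
    proof -
      have "hi (?w y k) - lo (?w y k) \<le> 1 / 2 ^ length (?w y k)" by (rule hi_minus_lo_le)
      also have "\<dots> \<le> 1 / 2 ^ k" by (intro divide_left_mono power_increasing) (auto simp: length_follow)
      finally show ?thesis using h[of y k] h[of y' k] follow_agree[OF that] by auto
    qed
    show "lo u < h y \<and> h y < hi u" for y
      using inI[of y 0] inI_append[of "h y" u "[2]"] by (simp add: inI_def)
    show "won S y (h y)" if y: "(\<forall>n. honest F z n y) \<or> finite {p. y p}" for y
    proof -
      \<comment> \<open>Any word around \<open>h y\<close> is a prefix of a word of
        \<open>follow\<close>, so it contains no further restart.\<close>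
      have R: "restarts v \<le> ?R" if v: "inI (h y) v" for v
      proof -
        obtain w where "?w y (length v) = v @ w"
          using inI_prefix[OF v inI[of y "length v"]] by (auto simp: length_follow)
        then show ?thesis using restarts_append[of v w] restarts_follow[of \<sigma> u y "length v"] by simp
      qed
      have len: "\<exists>v. inI (h y) v \<and> restarts v = ?R \<and> length (toks ?R y k) < length (moves v)" for k
        using length_moves_follow_unbounded[of u y k \<sigma>] inI restarts_follow by blast
      have "label ?R y \<in> S"
        if unb: "\<not> (\<exists>k. \<forall>k'. length (toks ?R y k') \<le> k)"
          and match: "\<not> (\<exists>v i k. inI (h y) v \<and> restarts v = ?R \<and> i < length (moves v) \<and>
            i < length (toks ?R y k) \<and> moves v ! i \<noteq> claim (toks ?R y k ! i))"
      proof -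
        have unb': "\<exists>k. i < length (toks ?R y k)" for i using unb by (meson not_less)
        \<comment> \<open>Unboundedly many answers rule out the finite alternative.\<close>
        have "honest F z n y" for n
        proof -
          have "\<not> finite {p. y p}"
          proof
            assume fin: "finite {p. y p}"
            have "length (toks ?R y k) \<le> card {p. y p}" for k
            proof -
              have "length (toks ?R y k) = card (set (toks ?R y k))"
                by (rule distinct_card[symmetric]) (simp add: toks_def)
              also have "\<dots> \<le> card {p. y p}" by (rule card_mono[OF fin]) (auto simp: toks_def)
              finally show ?thesis .
            qed
            then show False using unb by blast
          qed
          then show ?thesis using y by blast
        qed
        note hon = this
        have mv: "\<exists>k. i < length (moves (?w y k))" for i
        proof -
          obtain k0 where "i < length (toks ?R y k0)" using unb' by blast
          moreover obtain k where "length (toks ?R y k0) < length (moves (?w y k))"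
            using length_moves_follow_unbounded by blast
          ultimately show ?thesis by (intro exI[of _ k]) simp
        qed
        \<comment> \<open>The play is read off from both sides: moves from the word, replies from
          the tokens, each at a stage where it is already present.\<close>
        define km where "km i = (SOME k. i < length (moves (?w y k)))" for i
        define kt where "kt i = (SOME k. i < length (toks ?R y k))" for i
        have km: "i < length (moves (?w y (km i)))" for i unfolding km_def using mv by (rule someI_ex)
        have kt: "i < length (toks ?R y (kt i))" for i unfolding kt_def using unb' by (rule someI_ex)
        define \<gamma> where "\<gamma> j = (let i = j div 2 in if even j then moves (?w y (km i)) ! i
          else reply (toks ?R y (kt i) ! i))" for j
        have mvnth: "moves (?w y k) ! i = moves (?w y (km i)) ! i" if "i < length (moves (?w y k))" for i k
        proof (cases "k \<le> km i")
          case True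
          then show ?thesis using moves_follow_mono[OF True, of \<sigma> u y] that by (auto simp: nth_append)
        next
          case False
          then have le: "km i \<le> k" by simp
          show ?thesis using moves_follow_mono[OF le, of \<sigma> u y] km[of i] by (auto simp: nth_append)
        qed
        have "\<gamma> (2 * i) = \<sigma> (map \<gamma> [0..<2 * i])" for i
        proof -
          let ?k = "km i"
          from moves_follow[OF km[of i]] have le: "i \<le> length (toks ?R y ?k)" and
            eq: "moves (?w y ?k) ! i = \<sigma> (map (\<lambda>j. if even j then moves (?w y ?k) ! (j div 2)
              else reply (toks ?R y ?k ! (j div 2))) [0..<2 * i])" by blast+
          have "map (\<lambda>j. if even j then moves (?w y ?k) ! (j div 2)
              else reply (toks ?R y ?k ! (j div 2))) [0..<2 * i] = map \<gamma> [0..<2 * i]"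
          proof (rule map_cong[OF refl])
            fix j assume "j \<in> set [0..<2 * i]"
            then have j: "j div 2 < i" by auto
            have "moves (?w y ?k) ! (j div 2) = moves (?w y (km (j div 2))) ! (j div 2)"
              using j km[of i] by (intro mvnth) simp
            moreover have "toks ?R y ?k ! (j div 2) = toks ?R y (kt (j div 2)) ! (j div 2)"
              using j le kt by (intro toks_nth_eq) auto
            ultimately show "(if even j then moves (?w y ?k) ! (j div 2)
              else reply (toks ?R y ?k ! (j div 2))) = \<gamma> j" by (simp add: \<gamma>_def Let_def)
          qed
          from eq[unfolded this] show ?thesis by (subst \<gamma>_def) simp
        qed
        then have "F z \<gamma> \<in> S" by (rule win)
        moreover have "label ?R y = F z \<gamma>"
        proof (rule label_eq_game[OF F hon unb'])
          fix i k assume i: "i < length (toks ?R y k)"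
          have "moves (?w y (km i)) ! i = claim (toks ?R y k ! i)"
            using match inI restarts_follow km i by blast
          moreover have "toks ?R y (kt i) ! i = toks ?R y k ! i"
            using toks_nth_eq[OF kt i] .
          ultimately show "\<gamma> (2 * i) = claim (toks ?R y k ! i) \<and> \<gamma> (Suc (2 * i)) = reply (toks ?R y k ! i)"
            by (simp add: \<gamma>_def)
        qed
        ultimately show ?thesis by simp
      qed
      then show ?thesis
        unfolding won_def using not_cut R len by (intro conjI exI[of _ ?R]) blast+
    qed
  qed
qed

section \<open>Clopen boxes bounded by graphs, and separation by open sets\<close>

lemma open_above_graph:
  fixes h :: "(nat \<Rightarrow> bool) \<Rightarrow> real"
  assumes h: "\<And>y k y'. agree k y y' \<Longrightarrow> \<bar>h y - h y'\<bar> \<le> 1 / 2 ^ k"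
  shows "open {p. h (fst p) < snd p}" "open {p. snd p < h (fst p)}"
proof -
  have *: "\<exists>n. \<forall>q. near n p q \<longrightarrow> \<bar>(snd p - h (fst p)) - (snd q - h (fst q))\<bar> < e" if "e > 0" for e and p
  proof -
    have "0 < e / 2" using that by simp
    then obtain n where n: "1 / 2 ^ n < e / 2" using exists_half_power_less by blast
    have "\<bar>(snd p - h (fst p)) - (snd q - h (fst q))\<bar> < e" if "near n p q" for q
      using that h[of n "fst p" "fst q"] n unfolding near_def by linarith
    then show ?thesis by blast
  qed
  show "open {p. h (fst p) < snd p}"
    unfolding open_near_iff
  proof
    fix p assume "p \<in> {p. h (fst p) < snd p}"
    then have "0 < snd p - h (fst p)" by simp
    from *[OF this, of p] show "\<exists>n. \<forall>q. near n p q \<longrightarrow> q \<in> {p. h (fst p) < snd p}" by fastforce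
  qed
  show "open {p. snd p < h (fst p)}"
    unfolding open_near_iff
  proof
    fix p assume "p \<in> {p. snd p < h (fst p)}"
    then have "0 < h (fst p) - snd p" by simp
    from *[OF this, of p] show "\<exists>n. \<forall>q. near n p q \<longrightarrow> q \<in> {p. snd p < h (fst p)}" by fastforce
  qed
qed

definition slice :: "(nat \<Rightarrow> bool) set \<Rightarrow> (nat \<Rightarrow> bool) set \<Rightarrow> ((nat \<Rightarrow> bool) \<times> real) set" where
  "slice S C = {p \<in> arena S. fst p \<in> C}"

text \<open>Basic neighbourhoods are cylinders cut off by one graph below and one above the point.
  As the graphs miss the slice, lying between them is both open and closed there.\<close>

lemma zero_dimensional_slice:
  assumes sel: "\<And>u. \<exists>h. (\<forall>y k y'. agree k y y' \<longrightarrow> \<bar>h y - h y'\<bar> \<le> 1 / 2 ^ k) \<and>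
      (\<forall>y. lo u < h y \<and> h y < hi u) \<and> (\<forall>y\<in>C. won S y (h y))"
  shows "zero_dimensional (top_of_set (slice S C))"
proof -
  let ?E = "slice S C"
  have sel': "\<exists>h. (\<forall>y k y'. agree k y y' \<longrightarrow> \<bar>h y - h y'\<bar> \<le> 1 / 2 ^ k) \<and>
      (\<forall>y. a < h y \<and> h y < b) \<and> (\<forall>p\<in>?E. h (fst p) \<noteq> snd p)" if "a < b" for a b :: real
  \<comment> \<open>An interval that sticks out of \<open>{0..1}\<close> contains a constant outside
    the strip, which settles points at height 0 or 1.\<close>
  proof (cases "a < 0 \<or> 1 < b")
    case True
    then obtain c where c: "a < c" "c < b" "c \<notin> {0..1}"
    proof (elim disjE)
      assume "a < 0"
      then obtain c where "a < c" "c < min b 0" using dense[of a "min b 0"] \<open>a < b\<close> by auto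
      then show thesis by (intro that) auto
    next
      assume "1 < b"
      then obtain c where "max a 1 < c" "c < b" using dense[of "max a 1" b] \<open>a < b\<close> by auto
      then show thesis by (intro that) auto
    qed
    then show ?thesis by (intro exI[of _ "\<lambda>_. c"]) (auto simp: slice_def arena_def)
  next
    case False
    then obtain u where u: "a < lo u" "hi u < b" using exists_inI_subset[of a b] \<open>a < b\<close> by auto
    from sel[of u] obtain h where h: "\<And>y k y'. agree k y y' \<Longrightarrow> \<bar>h y - h y'\<bar> \<le> 1 / 2 ^ k"
      "\<And>y. lo u < h y \<and> h y < hi u" "\<And>y. y \<in> C \<Longrightarrow> won S y (h y)" by blast
    have "a < h y \<and> h y < b" for y using h(2)[of y] u by auto
    moreover have "h (fst p) \<noteq> snd p" if "p \<in> ?E" for p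
      using that h(3)[of "fst p"] by (auto simp: slice_def arena_def)
    ultimately show ?thesis using h(1) by blast
  qed
  have "\<exists>B. openin (top_of_set ?E) B \<and> closedin (top_of_set ?E) B \<and> p \<in> B \<and> B \<subseteq> W"
    if W: "openin (top_of_set ?E) W" "p \<in> W" for W p
  proof -
    obtain W' where W': "open W'" "W = ?E \<inter> W'" using W(1) by (auto simp: openin_open)
    then obtain n where n: "\<And>q. near n p q \<Longrightarrow> q \<in> W'" using W(2) unfolding open_near_iff by blast
    have "snd p - 1 / 2 ^ n < snd p" "snd p < snd p + 1 / 2 ^ n" by simp_all
    from sel'[OF this(1)] sel'[OF this(2)] obtain g h where
      g: "\<And>y k y'. agree k y y' \<Longrightarrow> \<bar>g y - g y'\<bar> \<le> 1 / 2 ^ k"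
        "\<And>y. snd p - 1 / 2 ^ n < g y \<and> g y < snd p" "\<And>p. p \<in> ?E \<Longrightarrow> g (fst p) \<noteq> snd p" and
      h: "\<And>y k y'. agree k y y' \<Longrightarrow> \<bar>h y - h y'\<bar> \<le> 1 / 2 ^ k"
        "\<And>y. snd p < h y \<and> h y < snd p + 1 / 2 ^ n" "\<And>p. p \<in> ?E \<Longrightarrow> h (fst p) \<noteq> snd p"
      by metis
    define B where "B = {q \<in> ?E. agree n (fst p) (fst q) \<and> g (fst q) < snd q \<and> snd q < h (fst q)}"
    have op: "open {q :: (nat \<Rightarrow> bool) \<times> real. agree n (fst p) (fst q)}"
      "open {q :: (nat \<Rightarrow> bool) \<times> real. \<not> agree n (fst p) (fst q)}"
    proof -
      have *: "agree n y y' \<Longrightarrow> agree n (fst p) y' \<longleftrightarrow> agree n (fst p) y" for y y'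
        by (auto simp: agree_def)
      show "open {q :: (nat \<Rightarrow> bool) \<times> real. agree n (fst p) (fst q)}"
        by (rule open_vimage_fst_agree, rule exI[of _ n]) (simp add: *)
      show "open {q :: (nat \<Rightarrow> bool) \<times> real. \<not> agree n (fst p) (fst q)}"
        by (rule open_vimage_fst_agree, rule exI[of _ n]) (simp add: *)
    qed
    have "open ({q. agree n (fst p) (fst q)} \<inter> {q. g (fst q) < snd q} \<inter> {q. snd q < h (fst q)})"
      by (intro open_Int op open_above_graph g(1) h(1))
    moreover have "B = ?E \<inter> ({q. agree n (fst p) (fst q)} \<inter> {q. g (fst q) < snd q} \<inter> {q. snd q < h (fst q)})"
      by (auto simp: B_def)
    ultimately have "openin (top_of_set ?E) B" by (auto simp: openin_open)
    moreover have "closedin (top_of_set ?E) B"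
    proof -
      have "open ({q. \<not> agree n (fst p) (fst q)} \<union> {q. snd q < g (fst q)} \<union> {q. h (fst q) < snd q})"
        by (intro open_Un op open_above_graph g(1) h(1))
      moreover have "?E - B = ?E \<inter> ({q. \<not> agree n (fst p) (fst q)} \<union> {q. snd q < g (fst q)} \<union> {q. h (fst q) < snd q})"
        using g(3) h(3) by (auto simp: B_def) (meson linorder_neqE_linordered_idom)+
      ultimately have "openin (top_of_set ?E) (?E - B)" by (auto simp: openin_open)
      then show ?thesis by (simp add: closedin_def) (auto simp: B_def)
    qed
    moreover have "p \<in> B" using W W' g(2) h(2) by (auto simp: B_def)
    moreover have "B \<subseteq> W"
    proof
      fix q assume q: "q \<in> B"
      then have "near n p q"
        using g(2)[of "fst q"] h(2)[of "fst q"] by (auto simp: near_def B_def)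
      then show "q \<in> W" using n q W'(2) by (auto simp: B_def)
    qed
    ultimately show ?thesis by blast
  qed
  then show ?thesis
    unfolding zero_dimensional_def
    by (intro exI[of _ "{B. openin (top_of_set ?E) B \<and> closedin (top_of_set ?E) B}"]) auto
qed

text \<open>Halve the radii: if two balls met, the wider one before halving would reach the centre
  of the other. This turns a clopen partition of a slice into disjoint open sets of the ambient
  space.\<close>

lemma separate_by_open:
  fixes A B :: "((nat \<Rightarrow> bool) \<times> real) set"
  assumes "open V1" "A \<subseteq> V1" "B \<inter> V1 = {}" "open V2" "B \<subseteq> V2" "A \<inter> V2 = {}"
  obtains U V where "open U" "open V" "A \<subseteq> U" "B \<subseteq> V" "U \<inter> V = {}"
proof -
  have "\<forall>a\<in>A. \<exists>n. \<forall>q. near n a q \<longrightarrow> q \<notin> B" using assms(1-3) unfolding open_near_iff by blast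
  then obtain m where m: "\<And>a q. a \<in> A \<Longrightarrow> near (m a) a q \<Longrightarrow> q \<notin> B" by metis
  have "\<forall>b\<in>B. \<exists>n. \<forall>q. near n b q \<longrightarrow> q \<notin> A" using assms(4-6) unfolding open_near_iff by blast
  then obtain n where n: "\<And>b q. b \<in> B \<Longrightarrow> near (n b) b q \<Longrightarrow> q \<notin> A" by metis
  let ?U = "\<Union>a\<in>A. {q. near (Suc (m a)) a q}" and ?V = "\<Union>b\<in>B. {q. near (Suc (n b)) b q}"
  show thesis
  proof (rule that[of ?U ?V])
    show "?U \<inter> ?V = {}"
    proof (rule ccontr)
      assume "?U \<inter> ?V \<noteq> {}"
      then obtain a b q where q: "a \<in> A" "b \<in> B" "near (Suc (m a)) a q" "near (Suc (n b)) b q" by blast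
      show False
      proof (cases "m a \<le> n b")
        case True
        then have "near (Suc (m a)) q b" using near_mono[OF q(4)] near_sym by simp
        from m[OF q(1) near_triangle[OF q(3) this]] show False using q(2) by blast
      next
        case False
        then have "near (Suc (n b)) q a" using near_mono[OF q(3)] near_sym by simp
        from n[OF q(2) near_triangle[OF q(4) this]] show False using q(1) by blast
      qed
    qed
  qed (auto intro: open_near)
qed

text \<open>\<open>U\<close> and \<open>V\<close> are disjoint outside the slice as well, where the
  limits of nested intervals will lie. \<open>C\<close> may be larger than the set of honest points,
  leaving room for those added for continuity.\<close>

locale separated_slice =
  fixes F :: "(nat \<Rightarrow> bool) \<Rightarrow> (nat \<Rightarrow> nat) \<Rightarrow> nat \<Rightarrow> bool" and z :: "nat \<Rightarrow> bool"
    and S C :: "(nat \<Rightarrow> bool) set" and U V :: "((nat \<Rightarrow> bool) \<times> real) set"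
  assumes lipschitz: "lipschitz_game F"
    and honest_C: "(\<And>n. honest F z n y) \<Longrightarrow> y \<in> C"
    and open_U: "open U" and open_V: "open V" and disjoint: "U \<inter> V = {}"
    and cover: "slice S C \<subseteq> U \<union> V"
    and bottom: "(\<lambda>_. False, 0) \<in> U" and top: "(\<lambda>_. False, 1) \<in> V"
begin

definition good :: "(nat \<Rightarrow> bool) \<Rightarrow> nat list \<Rightarrow> bool" where
  "good y u \<longleftrightarrow> (y, lo u) \<in> U \<and> (y, hi u) \<in> V"

lemma good_open:
  assumes "good y u" obtains N where "M \<le> N" "\<And>y'. agree N y y' \<Longrightarrow> good y' u"
proof -
  obtain m where m: "\<And>q. near m (y, lo u) q \<Longrightarrow> q \<in> U"
    using assms open_U unfolding good_def open_near_iff by blast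
  obtain n where n: "\<And>q. near n (y, hi u) q \<Longrightarrow> q \<in> V"
    using assms open_V unfolding good_def open_near_iff by blast
  show thesis
  proof (rule that[of "max M (max m n)"])
    fix y' assume "agree (max M (max m n)) y y'"
    then have "agree m y y'" "agree n y y'" by (auto elim: agree_mono)
    then show "good y' u" unfolding good_def by (auto intro: m n simp: near_def)
  qed simp
qed

text \<open>The left end points of the children run from \<open>lo u\<close> in \<open>U\<close>
  towards \<open>hi u\<close> in \<open>V\<close>, so there is a first one in \<open>V\<close>. Its
  predecessor is a cut, therefore in the slice, and hence in \<open>U\<close>.\<close>

lemma good_snoc:
  assumes y: "y \<in> C" and good: "good y u" shows "\<exists>n. good y (u @ [n])"
proof -
  obtain e where e: "\<And>q. near e (y, hi u) q \<Longrightarrow> q \<in> V"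
    using good open_V unfolding good_def open_near_iff by blast
  have "eventually (\<lambda>n. dist (lo (u @ [n])) (hi u) < 1 / 2 ^ e) sequentially"
    using lo_snoc_tendsto[of u] by (rule tendstoD) simp
  then obtain N where "dist (lo (u @ [N])) (hi u) < 1 / 2 ^ e" by (auto simp: eventually_sequentially)
  then have "(y, lo (u @ [N])) \<in> V" by (intro e) (auto simp: near_def dist_real_def abs_minus_commute)
  define n where "n = (LEAST n. (y, lo (u @ [n])) \<in> V)"
  have n: "(y, lo (u @ [n])) \<in> V" unfolding n_def by (rule LeastI) fact
  have "n \<noteq> 0"
  proof
    assume "n = 0"
    then have "(y, lo u) \<in> V" using n by (simp add: lo_snoc_0)
    then show False using good disjoint by (auto simp: good_def)
  qed
  then obtain m where m: "n = Suc m" using not0_implies_Suc by blast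
  have "(y, lo (u @ [m])) \<notin> V"
    using not_less_Least[of m "\<lambda>n. (y, lo (u @ [n])) \<in> V"] m unfolding n_def by simp
  moreover have "(y, lo (u @ [m])) \<in> slice S C"
    using y lo_hi_in_cuts(1)[of "u @ [m]"] cuts_subset by (auto simp: slice_def arena_def won_def)
  ultimately have "(y, lo (u @ [m])) \<in> U" using cover by blast
  then have "good y (u @ [m])" using n by (simp add: good_def hi_snoc m)
  then show ?thesis ..
qed

text \<open>The limit is approached by points of \<open>U\<close> and by points of \<open>V\<close>,
  so it lies in neither open set and must be missing from the slice. Above a point of
  \<open>C\<close> this means that Player I has won.\<close>

lemma good_limit:
  assumes y: "y \<in> C" and good: "\<And>k. good y (u k)"
    and ext: "\<And>k. \<exists>w. u (Suc k) = u k @ w" and len: "\<And>k. k \<le> length (u k)"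
  obtains t where "won S y t" "\<And>k. inI t (u k)"
proof -
  obtain t where t: "\<And>k. lo (u k) \<le> t" "\<And>k. t \<le> hi (u k)" using nested_words_limit[of u] ext by blast
  have near: "near n (y, t) (y, lo (u (Suc n)))" "near n (y, t) (y, hi (u (Suc n)))" for n
  proof -
    have "hi (u (Suc n)) - lo (u (Suc n)) \<le> 1 / 2 ^ length (u (Suc n))" by (rule hi_minus_lo_le)
    also have "\<dots> \<le> 1 / 2 ^ Suc n" using len by (intro divide_left_mono power_increasing) auto
    also have "\<dots> < 1 / 2 ^ n" by (simp add: field_simps)
    finally show "near n (y, t) (y, lo (u (Suc n)))" "near n (y, t) (y, hi (u (Suc n)))"
      using t[of "Suc n"] by (auto simp: near_def)
  qed
  have "(y, t) \<notin> U"
  proof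
    assume "(y, t) \<in> U"
    then obtain n where "\<And>q. near n (y, t) q \<Longrightarrow> q \<in> U" using open_U unfolding open_near_iff by blast
    then show False using near(2)[of n] good[of "Suc n"] disjoint by (auto simp: good_def)
  qed
  moreover have "(y, t) \<notin> V"
  proof
    assume "(y, t) \<in> V"
    then obtain n where "\<And>q. near n (y, t) q \<Longrightarrow> q \<in> V" using open_V unfolding open_near_iff by blast
    then show False using near(1)[of n] good[of "Suc n"] disjoint by (auto simp: good_def)
  qed
  ultimately have "(y, t) \<notin> slice S C" using cover by blast
  moreover have "t \<in> {0..1}" using t[of 0] lo_ge_0[of "u 0"] hi_le_1[of "u 0"] by auto
  ultimately have won: "won S y t" using y by (auto simp: slice_def arena_def)
  have "inI t (u k)" for k
  proof -
    have "t \<noteq> lo (u k)" "t \<noteq> hi (u k)" using won lo_hi_in_cuts[of "u k"] by (auto simp: won_def)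
    then show ?thesis using t[of k] by (simp add: inI_def)
  qed
  with won show thesis by (rule that)
qed

end

lemma agree_limit:
  assumes "\<And>k. agree (N k) (y k) (y (Suc k))" "\<And>k. N k < N (Suc k)"
  obtains Y where "\<And>k. agree (N k) (y k) Y" "\<And>k. k \<le> (N k :: nat)"
proof -
  have mono: "j \<le> k \<Longrightarrow> N j \<le> N k" for j k
    by (rule lift_Suc_mono_le) (simp add: assms(2) less_imp_le)
  have ge: "k \<le> N k" for k
    by (induction k) (use assms(2) in \<open>auto simp: Suc_le_eq intro: le_less_trans\<close>)
  have agree: "agree (N j) (y j) (y k)" if "j \<le> k" for j k
    using that
  proof (induction k rule: dec_induct)
    case (step k)
    then show ?case
      using agree_trans[OF _ agree_mono[OF assms(1) mono], of j "y j" k] by blast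
  qed simp
  \<comment> \<open>Coordinate \<open>p\<close> is final from stage \<open>Suc p\<close> on, because
    \<open>p < N (Suc p)\<close>.\<close>
  define Y where "Y p = y (Suc p) p" for p
  have "agree (N k) (y k) Y" for k
    unfolding agree_def
  proof (intro allI impI)
    fix p assume p: "p < N k"
    show "y k p = Y p"
    proof (cases "k \<le> Suc p")
      case True
      then show ?thesis using agree[OF True] p by (simp add: agree_def Y_def)
    next
      case False
      then have "agree (N (Suc p)) (y (Suc p)) (y k)" by (intro agree) simp
      then show ?thesis using ge[of "Suc p"] by (simp add: agree_def Y_def)
    qed
  qed
  then show thesis using ge by (rule that)
qed

subsection \<open>From partitions to strategies\<close>

context separated_slice
begin

text \<open>
  Positions just after a restart: all tokens issued so far are void, as their tags are too small.
\<close>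

definition fresh :: "(nat \<Rightarrow> bool) \<times> nat \<times> nat list \<Rightarrow> bool" where
  "fresh = (\<lambda>(y, N, u). (\<forall>n. honest F z n y) \<and> (\<forall>p\<ge>N. \<not> y p) \<and> (\<forall>p. y p \<longrightarrow> tag p < restarts u) \<and>
     moves u = [] \<and> (\<forall>y'. agree N y y' \<longrightarrow> good y' u))"

definition extends :: "(nat \<Rightarrow> bool) \<times> nat \<times> nat list \<Rightarrow> (nat \<Rightarrow> bool) \<times> nat \<times> nat list \<Rightarrow> bool" where
  "extends = (\<lambda>(y, N, u) (y', N', u'). agree N y y' \<and> N < N' \<and> (\<exists>w. u' = u @ w))"

lemma honest_limit:
  assumes "\<And>k. agree (N k) (y k) Y" "\<And>k. k \<le> N k" "\<And>k n. honest F z n (y k)"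
  shows "honest F z n Y"
  using honest_agree[OF lipschitz agree_refl agree_mono[OF assms(1,2)] assms(3)] .

text \<open>Otherwise dependent choice yields a chain of fresh positions with ever more restarts.
  Its limit is honest, so the limit point is won, yet it lies inside intervals with unboundedly many
  restarts.\<close>

lemma exists_last_fresh:
  obtains s where "fresh s"
    "\<And>s'. fresh s' \<Longrightarrow> extends s s' \<Longrightarrow> restarts (snd (snd s')) \<le> restarts (snd (snd s))"
proof (rule ccontr)
  assume "\<not> thesis"
  then have step: "\<exists>s'. fresh s' \<and> extends s s' \<and> restarts (snd (snd s)) < restarts (snd (snd s'))"
    if "fresh s" for s
    using that \<open>\<And>s. \<lbrakk>fresh s; \<And>s'. \<lbrakk>fresh s'; extends s s'\<rbrakk> \<Longrightarrow> restarts (snd (snd s')) \<le> restarts (snd (snd s))\<rbrakk> \<Longrightarrow> thesis\<close>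
    by (meson not_less)
  have "good (\<lambda>_. False) []" using bottom top by (simp add: good_def)
  then obtain N0 where N0: "\<And>y'. agree N0 (\<lambda>_. False) y' \<Longrightarrow> good y' []" using good_open by blast
  have "fresh (\<lambda>_. False, N0, [])" using N0 by (simp add: fresh_def honest_def)
  then have "\<exists>s. fresh s" by blast
  from dependent_nat_choice[of "\<lambda>_ s. fresh s" "\<lambda>_ s s'. extends s s' \<and> restarts (snd (snd s)) < restarts (snd (snd s'))",
      OF this] step
  obtain f where f: "\<And>k. fresh (f k)" "\<And>k. extends (f k) (f (Suc k))"
    "\<And>k. restarts (snd (snd (f k))) < restarts (snd (snd (f (Suc k))))"
    by metis
  define y N u where "y k = fst (f k)" and "N k = fst (snd (f k))" and "u k = snd (snd (f k))" for k
  have fk: "f k = (y k, N k, u k)" for k by (simp add: y_def N_def u_def)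
  have ext: "agree (N k) (y k) (y (Suc k))" "N k < N (Suc k)" "\<exists>w. u (Suc k) = u k @ w" for k
    using f(2)[of k] by (simp_all add: extends_def fk)
  have fresh: "honest F z n (y k)" "agree (N k) (y k) y' \<Longrightarrow> good y' (u k)" for k n y'
    using f(1)[of k] by (simp_all add: fresh_def fk)
  obtain Y where Y: "\<And>k. agree (N k) (y k) Y" "\<And>k. k \<le> N k"
    using agree_limit[of N y] ext by blast
  have "Y \<in> C" using honest_C honest_limit[OF Y fresh(1)] by blast
  have restarts: "k \<le> restarts (u k)" for k
    by (induction k) (use f(3) in \<open>auto simp: u_def Suc_le_eq intro: le_less_trans\<close>)
  obtain t where t: "won S Y t" "\<And>k. inI t (u k)"
  proof (rule good_limit[OF \<open>Y \<in> C\<close>, of u])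
    show "k \<le> length (u k)" for k using restarts[of k] restarts_le_length[of "u k"] by simp
  qed (use fresh(2)[OF Y(1)] ext(3) in auto)
  from t(1) obtain R where "\<And>v. inI t v \<Longrightarrow> restarts v \<le> R" unfolding won_def by blast
  then have "restarts (u (Suc R)) \<le> R" using t(2) by blast
  then show False using restarts[of "Suc R"] by simp
qed

end

locale last_fresh_position = separated_slice +
  fixes y0 :: "nat \<Rightarrow> bool" and N0 :: nat and u0 :: "nat list" and R :: nat
  assumes fresh0: "fresh (y0, N0, u0)"
    and last: "\<And>s'. fresh s' \<Longrightarrow> extends (y0, N0, u0) s' \<Longrightarrow> restarts (snd (snd s')) \<le> restarts u0"
    and R: "R = restarts u0"
begin

text \<open>The tokens with tag \<open>R\<close> answer the moves of \<open>u\<close> faithfully and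
  in order; all others have smaller tags. Goodness is demanded on a whole cylinder so that it
  survives later tokens.\<close>

definition reached :: "(nat \<Rightarrow> bool) \<times> nat \<times> nat list \<Rightarrow> bool" where
  "reached = (\<lambda>(y, N, u). (\<forall>n. honest F z n y) \<and> (\<forall>p\<ge>N. \<not> y p) \<and> (\<forall>p. y p \<longrightarrow> tag p \<le> R) \<and>
     agree N0 y0 y \<and> N0 \<le> N \<and> (\<exists>w. u = u0 @ w) \<and> restarts u = R \<and>
     (\<forall>y'. agree N y y' \<longrightarrow> good y' u) \<and>
     (\<forall>i<length (toks R y N). i < length (moves u) \<and> claim (toks R y N ! i) = moves u ! i))"

lemma reached_initial: "reached (y0, N0, u0)" "toks R y0 N0 = []"
proof -
  have tag: "tag p < R" if "y0 p" for p using fresh0 R that by (auto simp: fresh_def)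
  show toks: "toks R y0 N0 = []"
    unfolding toks_def using tag by (auto simp: filter_empty_conv)
  show "reached (y0, N0, u0)"
    unfolding reached_def using fresh0 R tag toks by (auto simp: fresh_def intro: less_imp_le)
qed

text \<open>Let Player II stay silent and descend through good children forever. The limit is won,
  so at some finite stage the moves outnumber the tokens.\<close>

lemma reached_next_move:
  assumes reached: "reached (y, N, u)"
  obtains u' where "\<exists>w. u' = u @ w" "restarts u' = R" "good y u'" "length (toks R y N) < length (moves u')"
proof -
  have y: "\<And>n. honest F z n y" "\<And>p. p \<ge> N \<Longrightarrow> \<not> y p" "\<And>p. y p \<Longrightarrow> tag p \<le> R" "agree N0 y0 y" "N0 \<le> N"
    "\<exists>w. u = u0 @ w" "restarts u = R" "good y u"
    using reached by (auto simp: reached_def)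
  have "y \<in> C" using honest_C y(1) by blast
  define g where "g v = (SOME n. good y (v @ [n]))" for v
  define c where "c = rec_nat u (\<lambda>_ v. v @ [g v])"
  have c: "c 0 = u" "c (Suc k) = c k @ [g (c k)]" for k by (simp_all add: c_def)
  have good: "good y (c k)" for k
  proof (induction k)
    case (Suc k)
    from someI_ex[OF good_snoc[OF \<open>y \<in> C\<close> this]] show ?case by (simp add: c g_def)
  qed (use y c in simp)
  have len: "k \<le> length (c k)" for k by (induction k) (simp_all add: c)
  have pre: "\<exists>w. c k = u @ w" for k
    by (induction k) (auto simp: c)
  obtain t where t: "won S y t" "\<And>k. inI t (c k)"
    by (rule good_limit[OF \<open>y \<in> C\<close>, of c]) (use good c len in auto)
  have restarts: "restarts (c k) = R" for k
  proof (induction k)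
    case (Suc k)
    show ?case
    proof (rule ccontr)
      assume neq: "restarts (c (Suc k)) \<noteq> R"
      then have "g (c k) = 2" using Suc by (auto simp: c restarts_snoc split: if_splits)
      then have new: "restarts (c (Suc k)) = Suc R" "moves (c (Suc k)) = []"
        using Suc by (simp_all add: c restarts_snoc moves_snoc)
      obtain M where M: "Suc N \<le> M" "\<And>y'. agree M y y' \<Longrightarrow> good y' (c (Suc k))"
        using good_open[OF good] by blast
      \<comment> \<open>After a restart all existing tokens have tags below the new count, so the
        position is fresh and contradicts the choice of the last fresh one.\<close>
      have "fresh (y, M, c (Suc k))"
        using y(1-3) M new by (auto simp: fresh_def less_Suc_eq_le)
      moreover have "extends (y0, N0, u0) (y, M, c (Suc k))"
        using y(4-6) M(1) pre[of "Suc k"] by (auto simp: extends_def)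
      ultimately show False using last new(1) R by fastforce
    qed
  qed (use c y in simp)
  from t(1) obtain R' where R': "\<And>v. inI t v \<Longrightarrow> restarts v \<le> R'"
    "\<And>k. \<exists>v. inI t v \<and> restarts v = R' \<and> length (toks R' y k) < length (moves v)"
    unfolding won_def by blast
  obtain v where v: "inI t v" "restarts v = R'" "length (toks R' y N) < length (moves v)"
    using R'(2) by blast
  obtain w where w: "c (length v) = v @ w" using inI_prefix[OF v(1) t(2) len] by blast
  have "R' = R"
    using R'(1)[OF t(2), of 0] restarts restarts_append[of v w] v(2) w by (metis le_antisym)
  have "restarts (v @ w) = restarts v" using restarts[of "length v"] w v(2) \<open>R' = R\<close> by simp
  from moves_append[OF this] have "length (toks R y N) < length (moves (c (length v)))"
    using v(3) \<open>R' = R\<close> w by auto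
  then show thesis using pre restarts good by (intro that[of "c (length v)"])
qed

lemma reached_answer:
  assumes reached: "reached (y, N, u)" and u': "u' = u @ w" "restarts u' = R" "good y u'"
    "length (toks R y N) < length (moves u')"
  shows "\<exists>y' N' p. reached (y', N', u') \<and> agree N y y' \<and> N < N' \<and> toks R y' N' = toks R y N @ [p] \<and>
    claim p = moves u' ! length (toks R y N) \<and> reply p = n"
proof -
  have y: "\<And>n. honest F z n y" "\<And>p. p \<ge> N \<Longrightarrow> \<not> y p" "\<And>p. y p \<Longrightarrow> tag p \<le> R" "agree N0 y0 y" "N0 \<le> N"
    "\<exists>w. u = u0 @ w" "restarts u = R" and
    claims: "\<And>i. i < length (toks R y N) \<Longrightarrow> i < length (moves u) \<and> claim (toks R y N ! i) = moves u ! i"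
    using reached by (auto simp: reached_def)
  let ?ps = "toks R y N"
  obtain M where M: "N \<le> M" "\<And>y'. agree M y y' \<Longrightarrow> good y' u'"
    using good_open[OF u'(3)] by blast
  \<comment> \<open>Beyond \<open>M\<close> the new token cannot spoil goodness, and its bit is the
    one that honesty prescribes.\<close>
  obtain p where p: "M \<le> p" "tag p = R" "claim p = moves u' ! length ?ps" "reply p = n"
    "bit p = F z (play ?ps) (length ?ps)"
    using exists_token by blast
  define y' where "y' = y(p := True)"
  have toks_p: "toks R y p = ?ps"
  proof -
    have "toks R y q = ?ps" if "N \<le> q" for q
      using that by (induction q rule: dec_induct) (auto simp: toks_Suc y(2))
    from this[OF order_trans[OF M(1) p(1)]] show ?thesis .
  qed
  have agree: "agree p y y'" by (auto simp: y'_def agree_def)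
  have toks': "toks R y' (Suc p) = ?ps @ [p]"
    using toks_agree[OF agree, of R] toks_p p(2) by (simp add: toks_Suc y'_def)
  have "honest F z k y'" for k
    unfolding honest_def
  proof (intro allI impI)
    fix q assume q: "q < k" "y' q"
    have "q < N \<or> q = p" using q(2) y(2)[of q] by (auto simp: y'_def not_less[symmetric] split: if_splits)
    then have "q \<le> p" using M(1) p(1) by auto
    then have eq: "toks (tag q) y' q = toks (tag q) y q"
      using toks_agree[OF agree_mono[OF agree], of q "tag q"] by simp
    show "bit q = F z (play (toks (tag q) y' q)) (length (toks (tag q) y' q))"
    proof (cases "q = p")
      case True
      then show ?thesis using p(2,5) toks_p eq by simp
    next
      case False
      then have "y q" using q(2) by (simp add: y'_def)
      then show ?thesis using y(1)[of "Suc q"] eq by (simp add: honest_def)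
    qed
  qed
  moreover have "\<not> y' q" if "q \<ge> Suc p" for q using that y(2)[of q] M(1) p(1) by (simp add: y'_def)
  moreover have "tag q \<le> R" if "y' q" for q using that y(3)[of q] p(2) by (auto simp: y'_def split: if_splits)
  moreover have "agree N0 y0 y'"
    using agree_trans[OF y(4) agree_mono[OF agree]] y(5) M(1) p(1) by simp
  moreover have "\<exists>w. u' = u0 @ w" using y(6) u'(1) by auto
  moreover have "good y'' u'" if "agree (Suc p) y' y''" for y''
    using M(2) agree_trans[OF agree_mono[OF agree p(1)] agree_mono[OF that]] p(1) by simp
  moreover have "i < length (moves u') \<and> claim (toks R y' (Suc p) ! i) = moves u' ! i"
    if "i < length (toks R y' (Suc p))" for i
  proof (cases "i < length ?ps")
    case True
    obtain l where "moves u' = moves u @ l" using moves_append[of u w] u'(1,2) y(7) by auto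
    then show ?thesis using claims[OF True] True by (simp add: toks' nth_append)
  next
    case False
    then have "i = length ?ps" using that by (simp add: toks')
    then show ?thesis using p(3) u'(4) by (simp add: toks')
  qed
  ultimately have "reached (y', Suc p, u')"
    using y(5) M(1) p(1) u'(2) unfolding reached_def by (simp add: le_SucI)
  moreover have "agree N y y'" "N < Suc p" using agree_mono[OF agree] M(1) p(1) by simp_all
  ultimately show ?thesis using toks' p(3,4) by blast
qed

definition answers :: "(nat \<Rightarrow> bool) \<times> nat \<times> nat list \<Rightarrow> nat \<Rightarrow> nat \<Rightarrow> (nat \<Rightarrow> bool) \<times> nat \<times> nat list \<Rightarrow> bool" where
  "answers s m n s' \<longleftrightarrow> extends s s' \<and>
     (\<exists>p. toks R (fst s') (fst (snd s')) = toks R (fst s) (fst (snd s)) @ [p] \<and> claim p = m \<and> reply p = n)"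

text \<open>The order of the quantifiers is the point: the move is fixed before the reply is known,
  as a strategy requires.\<close>

lemma reached_step:
  assumes "reached s" shows "\<exists>m. \<forall>n. \<exists>s'. reached s' \<and> answers s m n s'"
proof -
  obtain y N u where s: "s = (y, N, u)" by (cases s)
  obtain u' w where u': "u' = u @ w" "restarts u' = R" "good y u'" "length (toks R y N) < length (moves u')"
    using reached_next_move assms unfolding s by metis
  show ?thesis
  proof (intro exI[of _ "moves u' ! length (toks R y N)"] allI)
    fix n
    from reached_answer[OF assms[unfolded s] u', of n] obtain y' N' p where
      "reached (y', N', u')" "agree N y y'" "N < N'" "toks R y' N' = toks R y N @ [p]"
      "claim p = moves u' ! length (toks R y N)" "reply p = n" by blast
    then show "\<exists>s'. reached s' \<and> answers s (moves u' ! length (toks R y N)) n s'"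
      using u'(1) by (intro exI[of _ "(y', N', u')"]) (auto simp: answers_def extends_def s)
  qed
qed

lemma exists_winning_strategy:
  "\<exists>\<sigma>. \<forall>\<gamma>. (\<forall>k. \<gamma> (2 * k) = \<sigma> (map \<gamma> [0..<2 * k])) \<longrightarrow> F z \<gamma> \<in> S"
proof -
  define move where "move s = (SOME m. \<forall>n. \<exists>s'. reached s' \<and> answers s m n s')" for s
  define succ where "succ s n = (SOME s'. reached s' \<and> answers s (move s) n s')" for s n
  have move: "\<exists>s'. reached s' \<and> answers s (move s) n s'" if "reached s" for s n
    using someI_ex[OF reached_step[OF that]] unfolding move_def by blast
  have succ: "reached (succ s n) \<and> answers s (move s) n (succ s n)" if "reached s" for s n
    unfolding succ_def using someI_ex[OF move[OF that]] .
  define s0 where "s0 = (y0, N0, u0)"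
  \<comment> \<open>The odd entries, the replies of Player II, suffice to reconstruct the position;
    Player I's own moves are determined by them.\<close>
  define \<sigma> where "\<sigma> l = move (foldl succ s0 (map (\<lambda>j. l ! Suc (2 * j)) [0..<length l div 2]))" for l :: "nat list"
  have "F z \<gamma> \<in> S" if \<gamma>: "\<And>k. \<gamma> (2 * k) = \<sigma> (map \<gamma> [0..<2 * k])" for \<gamma>
  proof -
    define f where "f k = foldl succ s0 (map (\<lambda>j. \<gamma> (Suc (2 * j))) [0..<k])" for k
    have f: "f 0 = s0" "f (Suc k) = succ (f k) (\<gamma> (Suc (2 * k)))" for k by (simp_all add: f_def)
    have move_f: "move (f k) = \<gamma> (2 * k)" for k
    proof -
      have "map (\<lambda>j. map \<gamma> [0..<2 * k] ! Suc (2 * j)) [0..<length (map \<gamma> [0..<2 * k]) div 2] =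
          map (\<lambda>j. \<gamma> (Suc (2 * j))) [0..<k]"
        by (intro nth_equalityI) auto
      then show ?thesis unfolding \<gamma>[of k] \<sigma>_def f_def by (simp only:)
    qed
    have reached: "reached (f k)" for k
      by (induction k) (use succ reached_initial(1) f in \<open>auto simp: s0_def\<close>)
    have answers: "answers (f k) (\<gamma> (2 * k)) (\<gamma> (Suc (2 * k))) (f (Suc k))" for k
      using succ[OF reached, of k] move_f f(2) by metis
    define y N u where "y k = fst (f k)" and "N k = fst (snd (f k))" and "u k = snd (snd (f k))" for k
    have fk: "f k = (y k, N k, u k)" for k by (simp add: y_def N_def u_def)
    have ext: "agree (N k) (y k) (y (Suc k))" "N k < N (Suc k)" "\<exists>w. u (Suc k) = u k @ w" for k
      using answers[of k] by (auto simp: answers_def extends_def fk)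
    have r: "honest F z n (y k)" "restarts (u k) = R" "agree (N k) (y k) y' \<Longrightarrow> good y' (u k)"
      "i < length (toks R (y k) (N k)) \<Longrightarrow> i < length (moves (u k)) \<and>
        claim (toks R (y k) (N k) ! i) = moves (u k) ! i" for k n y' i
      using reached[of k] by (auto simp: reached_def fk)
    obtain Y where Y: "\<And>k. agree (N k) (y k) Y" "\<And>k. k \<le> N k"
      using agree_limit[of N y] ext by blast
    have toksY: "toks R Y (N k) = toks R (y k) (N k)" for k
      using toks_agree[OF Y(1)] by metis
    have toks_Suc: "\<exists>p. toks R Y (N (Suc k)) = toks R Y (N k) @ [p] \<and> claim p = \<gamma> (2 * k) \<and>
        reply p = \<gamma> (Suc (2 * k))" for k
      using answers[of k] by (simp add: answers_def fk toksY)
    \<comment> \<open>Each round adds exactly one token with tag \<open>R\<close>, so list indices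
      count rounds.\<close>
    have len: "length (toks R Y (N k)) = k" for k
    proof (induction k)
      case 0
      then show ?case using reached_initial(2) f(1) fk[of 0] toksY[of 0] by (simp add: s0_def)
    next
      case (Suc k)
      then show ?case using toks_Suc[of k] by auto
    qed
    have nth: "claim (toks R Y k ! i) = \<gamma> (2 * i) \<and> reply (toks R Y k ! i) = \<gamma> (Suc (2 * i))"
      if "i < length (toks R Y k)" for i k
    proof -
      obtain p where p: "toks R Y (N (Suc i)) = toks R Y (N i) @ [p]" "claim p = \<gamma> (2 * i)"
        "reply p = \<gamma> (Suc (2 * i))" using toks_Suc by blast
      have "toks R Y k ! i = toks R Y (N (Suc i)) ! i"
        using that len[of "Suc i"] by (intro toks_nth_eq) auto
      also have "\<dots> = p" using p(1) len[of i] by (simp add: nth_append)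
      finally show ?thesis using p by simp
    qed
    have hon: "honest F z n Y" for n by (rule honest_limit[OF Y r(1)])
    then have "Y \<in> C" by (rule honest_C)
    have moves_len: "k \<le> length (moves (u k))" for k
    proof (cases k)
      case (Suc i)
      then show ?thesis using r(4)[of i k] len[of k] toksY[of k] by simp
    qed simp
    have ulen: "k \<le> length (u k)" for k using moves_len[of k] length_moves_le[of "u k"] by simp
    obtain t where t: "won S Y t" "\<And>k. inI t (u k)"
      by (rule good_limit[OF \<open>Y \<in> C\<close>, of u]) (use r(3)[OF Y(1)] ext(3) ulen in auto)
    from t(1) obtain R' where R': "\<And>v. inI t v \<Longrightarrow> restarts v \<le> R'"
      "\<And>k. \<exists>v. inI t v \<and> restarts v = R' \<and> length (toks R' Y k) < length (moves v)" and
      payoff: "(\<exists>k. \<forall>k'. length (toks R' Y k') \<le> k) \<or>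
        (\<exists>u i k. inI t u \<and> restarts u = R' \<and> i < length (moves u) \<and> i < length (toks R' Y k) \<and>
          moves u ! i \<noteq> claim (toks R' Y k ! i)) \<or> label R' Y \<in> S"
      unfolding won_def by blast
    have prefix: "\<exists>w. u j = v @ w" if "inI t v" "length v \<le> j" for v j
      using inI_prefix[OF that(1) t(2)[of j]] that(2) ulen[of j] by simp
    have "R' = R"
    proof -
      obtain v where v: "inI t v" "restarts v = R'" using R'(2) by blast
      obtain w where "u (length v) = v @ w" using prefix[OF v(1)] by blast
      then show ?thesis
        using R'(1)[OF t(2), of 0] r(2) restarts_append[of v w] v(2) by (metis le_antisym)
    qed
    \<comment> \<open>Unboundedly many answers, all claiming the moves actually made, leave only the
      payoff alternative in \<open>won\<close>.\<close>
    have "\<not> (\<exists>k. \<forall>k'. length (toks R Y k') \<le> k)"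
      using len by (metis Suc_n_not_le_n)
    moreover have "moves v ! i = claim (toks R Y k ! i)"
      if v: "inI t v" "restarts v = R" "i < length (moves v)" "i < length (toks R Y k)" for v i k
    proof -
      let ?j = "max (length v) (Suc i)"
      obtain w where w: "u ?j = v @ w" using prefix[OF v(1)] by fastforce
      then have "restarts (v @ w) = restarts v" using r(2)[of ?j] v(2) by simp
      from moves_append[OF this] have "moves (u ?j) ! i = moves v ! i"
        using w v(3) by (auto simp: nth_append)
      moreover have i: "i < length (toks R Y (N ?j))" using len[of ?j] by simp
      then have "claim (toks R Y (N ?j) ! i) = moves (u ?j) ! i"
        using r(4)[of i ?j] toksY[of ?j] by simp
      moreover have "toks R Y (N ?j) ! i = toks R Y k ! i" using i v(4) by (rule toks_nth_eq)
      ultimately show ?thesis by simp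
    qed
    ultimately have "label R Y \<in> S" using payoff \<open>R' = R\<close> by blast
    moreover have "label R Y = F z \<gamma>"
    proof (rule label_eq_game[OF lipschitz hon])
      show "\<exists>k. i < length (toks R Y k)" for i using len[of "Suc i"] by (metis lessI)
    qed (use nth in simp)
    ultimately show ?thesis by simp
  qed
  then show ?thesis by (intro exI[of _ \<sigma>] allI impI) blast
qed

end

lemma zero_dimensional_slice_imp_winning_strategy:
  assumes F: "lipschitz_game F" and C: "\<And>y. (\<And>n. honest F z n y) \<Longrightarrow> y \<in> C"
    and zd: "zero_dimensional (top_of_set (slice S C))"
  shows "\<exists>\<sigma>. \<forall>\<gamma>. (\<forall>k. \<gamma> (2 * k) = \<sigma> (map \<gamma> [0..<2 * k])) \<longrightarrow> F z \<gamma> \<in> S"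
proof -
  let ?E = "slice S C" and ?o = "\<lambda>_ :: nat. False"
  have "?o \<in> C" by (rule C) (simp add: honest_def)
  moreover have "0 \<in> cuts" "1 \<in> cuts" using lo_hi_in_cuts[of "[]"] by simp_all
  ultimately have ends: "(?o, 0) \<in> ?E" "(?o, 1) \<in> ?E" by (auto simp: slice_def arena_def won_def)
  \<comment> \<open>This neighbourhood of the bottom point misses the top one, so a clopen set
    within it separates the two.\<close>
  have "open {p :: (nat \<Rightarrow> bool) \<times> real. snd p < 1}" by (intro open_Collect_less continuous_intros)
  then have "openin (top_of_set ?E) (?E \<inter> {p. snd p < 1})" by (auto simp: openin_open)
  moreover have "(?o, 0) \<in> ?E \<inter> {p. snd p < 1}" using ends by simp
  ultimately obtain B where B: "openin (top_of_set ?E) B" "closedin (top_of_set ?E) B" "(?o, 0) \<in> B"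
    "B \<subseteq> ?E \<inter> {p. snd p < 1}"
    using zd unfolding zero_dimensional_def by metis
  obtain V1 where V1: "open V1" "B = ?E \<inter> V1" using B(1) by (auto simp: openin_open)
  have "openin (top_of_set ?E) (?E - B)" using B(2) by (simp add: closedin_def)
  then obtain V2 where V2: "open V2" "?E - B = ?E \<inter> V2" by (auto simp: openin_open)
  obtain U V where UV: "open U" "open V" "B \<subseteq> U" "?E - B \<subseteq> V" "U \<inter> V = {}"
  proof (rule separate_by_open[OF V1(1) _ _ V2(1), of B "?E - B"])
    show "B \<inter> V2 = {}" using V2(2) B(4) by blast
    show "B \<subseteq> V1" "?E - B \<subseteq> V2" "(?E - B) \<inter> V1 = {}" using V1(2) V2(2) by blast+
  qed
  interpret separated_slice F z S C U V
    using UV F C B(3,4) ends by unfold_locales auto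
  obtain s where s: "fresh s"
    "\<And>s'. fresh s' \<Longrightarrow> extends s s' \<Longrightarrow> restarts (snd (snd s')) \<le> restarts (snd (snd s))"
    using exists_last_fresh by blast
  obtain y0 N0 u0 where "s = (y0, N0, u0)" by (cases s)
  then interpret last_fresh_position F z S C U V y0 N0 u0 "restarts u0"
    using s by unfold_locales auto
  show ?thesis by (rule exists_winning_strategy)
qed

subsection \<open>Continuity for an arbitrary compactification\<close>

lemma compact_metrizable_countable_base:
  assumes "compact_space Y" "metrizable_space Y"
  obtains W :: "nat \<Rightarrow> 'a set" where "\<And>n. openin Y (W n)"
    "\<And>U x. openin Y U \<Longrightarrow> x \<in> U \<Longrightarrow> \<exists>n. x \<in> W n \<and> W n \<subseteq> U"
proof -
  obtain M d where "Metric_space M d" and Y: "Y = Metric_space.mtopology M d"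
    using assms(2) by (auto simp: metrizable_space_def)
  then interpret Metric_space M d by simp
  have top: "topspace Y = M" by (simp add: Y)
  have "\<exists>\<F>. finite \<F> \<and> \<F> \<subseteq> (\<lambda>x. mball x (1 / Suc n)) ` M \<and> M \<subseteq> \<Union>\<F>" for n
  proof (rule compactinD)
    show "compactin Y M" using assms(1) top by (simp add: compact_space_def)
    show "openin Y U" if "U \<in> (\<lambda>x. mball x (1 / Suc n)) ` M" for U using that by (auto simp: Y)
    show "M \<subseteq> \<Union>((\<lambda>x. mball x (1 / Suc n)) ` M)" by auto
  qed
  then obtain \<F> where \<F>: "\<And>n. finite (\<F> n)" "\<And>n. \<F> n \<subseteq> (\<lambda>x. mball x (1 / Suc n)) ` M" "\<And>n. M \<subseteq> \<Union>(\<F> n)"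
    by metis
  \<comment> \<open>Inserting the empty set makes the family nonempty, as its enumeration requires
    even when \<open>Y\<close> is empty.\<close>
  define \<B> where "\<B> = insert {} (\<Union>n. \<F> n)"
  have "countable \<B>" using \<F>(1) by (auto simp: \<B>_def intro: countable_finite)
  then have range: "range (from_nat_into \<B>) = \<B>" by (intro range_from_nat_into) (auto simp: \<B>_def)
  show thesis
  proof (rule that[of "from_nat_into \<B>"])
    show "openin Y (from_nat_into \<B> n)" for n
    proof -
      have "from_nat_into \<B> n \<in> \<B>" using range by blast
      moreover have "openin Y B" if B: "B \<in> \<B>" for B
      proof (cases "B = {}")
        case False
        then obtain n where "B \<in> \<F> n" using B by (auto simp: \<B>_def)
        then obtain x where "B = mball x (1 / Suc n)" using \<F>(2) by blast
        then show ?thesis by (simp add: Y)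
      qed simp
      ultimately show ?thesis by blast
    qed
    fix U x assume U: "openin Y U" "x \<in> U"
    then obtain e where e: "e > 0" "mball x e \<subseteq> U" and x: "x \<in> M"
      unfolding Y openin_mtopology by blast
    obtain n where n: "1 / real (Suc n) < e / 2" using nat_approx_posE[of "e / 2"] e(1) by auto
    obtain B where B: "B \<in> \<F> n" "x \<in> B" using \<F>(3) x by blast
    then obtain c where c: "c \<in> M" "B = mball c (1 / Suc n)" using \<F>(2) by blast
    have "B \<subseteq> mball x e"
    proof
      fix w assume w: "w \<in> B"
      then have "d x w \<le> d c x + d c w" "d c x < 1 / Suc n" "d c w < 1 / Suc n"
        using c B(2) triangle[of x c w] commute[of c x] by (auto simp: in_mball)
      then show "w \<in> mball x e" using n w c x by (auto simp: in_mball)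
    qed
    moreover have "B \<in> \<B>" using B(1) by (auto simp: \<B>_def)
    ultimately show "\<exists>n. x \<in> from_nat_into \<B> n \<and> from_nat_into \<B> n \<subseteq> U"
      using range B(2) e(2) by (metis (no_types, lifting) imageE order_trans)
  qed
qed

lemma arena_subset: "arena S \<subseteq> strip"
  by (auto simp: arena_def)

text \<open>Truncate \<open>y\<close> and move \<open>t\<close> to a nearby cut: pairs at a cut are
  never won, so the result stays in the arena.\<close>

lemma arena_finite_dense:
  assumes W: "openin (top_of_set (arena S)) W" and yt: "(y, t) \<in> W"
  obtains y' t' where "agree n y y'" "finite {p. y' p}" "(y', t') \<in> W"
proof -
  obtain W' where W': "open W'" "W = arena S \<inter> W'" using W by (auto simp: openin_open)
  then obtain m where m: "\<And>q. near m (y, t) q \<Longrightarrow> q \<in> W'" using yt unfolding open_near_iff by blast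
  have t: "t \<in> {0..1}" using yt W' arena_subset by blast
  obtain c where c: "c \<in> cuts" "\<bar>t - c\<bar> < 1 / 2 ^ m"
  proof (cases "t \<in> cuts")
    case False
    then obtain u where "inI t u" "length u = m" using inI_word t by blast
    then show thesis using hi_minus_lo_le[of u] lo_hi_in_cuts[of u]
      by (intro that[of "lo u"]) (auto simp: inI_def)
  qed (use that[of t] in auto)
  define y' where "y' = (\<lambda>p. p < max m n \<and> y p)"
  show thesis
  proof (rule that[of y' c])
    show "agree n y y'" by (auto simp: agree_def y'_def)
    show "finite {p. y' p}" by (rule finite_subset[of _ "{..<max m n}"]) (auto simp: y'_def)
    have "near m (y, t) (y', c)" using c(2) by (auto simp: near_def agree_def y'_def)
    moreover have "(y', c) \<in> arena S" using c(1) cuts_subset by (auto simp: arena_def won_def)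
    ultimately show "(y', c) \<in> W" using m W' by blast
  qed
qed

text \<open>
  For the trace \<open>W n\<close> of each basic open set of the compactification, one point with finitely many
  tokens is added to the honest ones, so that the first \<open>n\<close> coordinates of \<open>z\<close> decide whether the
  slice attached to \<open>z\<close> meets \<open>W n\<close>.
\<close>

locale junk =
  fixes F :: "(nat \<Rightarrow> bool) \<Rightarrow> (nat \<Rightarrow> nat) \<Rightarrow> nat \<Rightarrow> bool" and S :: "(nat \<Rightarrow> bool) set"
    and W :: "nat \<Rightarrow> ((nat \<Rightarrow> bool) \<times> real) set"
  assumes lipschitz: "lipschitz_game F"
    and open_W: "\<And>n. openin (top_of_set (arena S)) (W n)"
begin

text \<open>Honesty is asked only up to \<open>n\<close>, so \<open>z\<close> matters through its
  first \<open>n\<close> coordinates; finiteness makes a point that is dishonest further on harmless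
  for the dimension. The default, the empty token set, is honest.\<close>

definition junk_point :: "nat \<Rightarrow> (nat \<Rightarrow> bool) \<Rightarrow> (nat \<Rightarrow> bool)" where
  "junk_point n z = (if \<exists>y t. (y, t) \<in> W n \<and> honest F z n y
     then SOME y. honest F z n y \<and> finite {p. y p} \<and> (\<exists>t. (y, t) \<in> W n) else (\<lambda>_. False))"

definition base :: "(nat \<Rightarrow> bool) \<Rightarrow> (nat \<Rightarrow> bool) set" where
  "base z = {y. \<forall>n. honest F z n y} \<union> range (\<lambda>n. junk_point n z)"

lemma junk_point_hits:
  assumes "(y, t) \<in> W n" "honest F z n y"
  shows "honest F z n (junk_point n z) \<and> finite {p. junk_point n z p} \<and> (\<exists>t. (junk_point n z, t) \<in> W n)"
proof -
  obtain y' t' where y': "agree n y y'" "finite {p. y' p}" "(y', t') \<in> W n"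
    using arena_finite_dense[OF open_W assms(1)] by blast
  have "honest F z n y'" using honest_agree[OF lipschitz agree_refl y'(1) assms(2)] .
  then have "\<exists>y. honest F z n y \<and> finite {p. y p} \<and> (\<exists>t. (y, t) \<in> W n)" using y' by blast
  from someI_ex[OF this] show ?thesis using assms unfolding junk_point_def by auto
qed

lemma junk_point: "honest F z n (junk_point n z)" "finite {p. junk_point n z p}"
proof -
  have "honest F z n (junk_point n z) \<and> finite {p. junk_point n z p}"
  proof (cases "\<exists>y t. (y, t) \<in> W n \<and> honest F z n y")
    case True
    then show ?thesis using junk_point_hits by blast
  next
    case False
    then have "junk_point n z = (\<lambda>_. False)" unfolding junk_point_def by (rule if_not_P)
    then show ?thesis by (simp add: honest_def)
  qed
  then show "honest F z n (junk_point n z)" "finite {p. junk_point n z p}" by auto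
qed

lemma base_cases: "y \<in> base z \<Longrightarrow> (\<forall>n. honest F z n y) \<or> finite {p. y p}"
  using junk_point(2) by (auto simp: base_def)

lemma honest_cong:
  assumes "agree n z z'" shows "honest F z n = honest F z' n"
  using honest_agree[OF lipschitz assms agree_refl] honest_agree[OF lipschitz agree_sym[OF assms] agree_refl]
  by blast

lemma junk_point_cong: "agree n z z' \<Longrightarrow> junk_point n z = junk_point n z'"
  unfolding junk_point_def by (simp only: honest_cong)

text \<open>If some \<open>y\<close> honest up to \<open>n\<close> hits \<open>W n\<close>, then so
  does \<open>junk_point n z\<close>, which \<open>z'\<close> shares. Any other \<open>y\<close> in
  \<open>base z\<close> is a junk point of index below \<open>n\<close>, shared as well.\<close>

lemma slice_meets_cong:
  assumes "agree n z z'" and meets: "slice S (base z) \<inter> W n \<noteq> {}"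
  shows "slice S (base z') \<inter> W n \<noteq> {}"
proof -
  obtain y t where yt: "(y, t) \<in> slice S (base z)" "(y, t) \<in> W n" using meets by auto
  have y: "y \<in> base z" using yt(1) by (simp add: slice_def)
  have hit: ?thesis if "y' \<in> base z'" "(y', t') \<in> W n" for y' t'
  proof -
    have "(y', t') \<in> arena S" using openin_subset[OF open_W[of n]] that(2) by auto
    then show ?thesis using that by (auto simp: slice_def)
  qed
  show ?thesis
  proof (cases "honest F z n y")
    case True
    from junk_point_hits[OF yt(2) this] obtain t' where "(junk_point n z, t') \<in> W n" by blast
    then show ?thesis using junk_point_cong[OF assms(1)] by (intro hit[of "junk_point n z"]) (auto simp: base_def)
  next
    case False
    then obtain k where k: "y = junk_point k z" using y by (auto simp: base_def)
    have "k < n" using False honest_mono[OF junk_point(1)[of z k], of n] k by (meson not_less)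
    then have "y = junk_point k z'" using k junk_point_cong agree_mono[OF assms(1)] by simp
    then show ?thesis using yt(2) by (intro hit[of y]) (auto simp: base_def)
  qed
qed

text \<open>Junk points of index at least \<open>n\<close> are honest up to \<open>n\<close>. Near a
  point that fails honesty below \<open>n\<close> only the finitely many earlier ones could occur,
  and a longer agreement excludes these.\<close>

lemma closedin_slice: "closedin (top_of_set (arena S)) (slice S (base z))"
proof -
  have "open {p :: (nat \<Rightarrow> bool) \<times> real. fst p \<notin> base z}"
  proof (rule open_vimage_fst_agree)
    fix y assume y: "y \<notin> base z"
    then obtain n where n: "\<not> honest F z n y" by (auto simp: base_def)
    have "\<exists>m. \<not> agree m y (junk_point k z)" for k
    proof -
      have "junk_point k z \<noteq> y" using y by (auto simp: base_def)
      then obtain i where "junk_point k z i \<noteq> y i" by blast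
      then show ?thesis by (intro exI[of _ "Suc i"]) (auto simp: agree_def)
    qed
    then obtain g where g: "\<And>k. \<not> agree (g k) y (junk_point k z)" by metis
    define m where "m = (\<Sum>k<n. g k)"
    have m: "\<not> agree m y (junk_point k z)" if "k < n" for k
    proof -
      have "g k \<le> m" unfolding m_def by (rule member_le_sum) (use that in auto)
      then show ?thesis using g agree_mono by blast
    qed
    have "y' \<notin> base z" if "agree (max m n) y y'" for y'
    proof
      assume "y' \<in> base z"
      have "agree m y y'" "agree n y' y" using that by (simp_all add: agree_def)
      have "\<not> honest F z n y'" using honest_agree[OF lipschitz agree_refl \<open>agree n y' y\<close>] n by blast
      then obtain k where k: "y' = junk_point k z" using \<open>y' \<in> base z\<close> by (auto simp: base_def)
      have "\<not> k < n" using m \<open>agree m y y'\<close> k by auto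
      then have "honest F z n y'" using honest_mono[OF junk_point(1)[of z k], of n] k by simp
      then show False using \<open>\<not> honest F z n y'\<close> by blast
    qed
    then show "\<exists>n. \<forall>y'. agree n y y' \<longrightarrow> y' \<notin> base z" by blast
  qed
  moreover have "arena S - slice S (base z) = arena S \<inter> {p. fst p \<notin> base z}" by (auto simp: slice_def)
  ultimately have "openin (top_of_set (arena S)) (arena S - slice S (base z))" by (auto simp: openin_open)
  then show ?thesis by (simp add: closedin_def) (auto simp: slice_def)
qed

lemma zero_dimensional_slice_iff:
  "zero_dimensional (top_of_set (slice S (base z))) \<longleftrightarrow>
     (\<exists>\<sigma>. \<forall>\<gamma>. (\<forall>k. \<gamma> (2 * k) = \<sigma> (map \<gamma> [0..<2 * k])) \<longrightarrow> F z \<gamma> \<in> S)"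
proof
  assume "zero_dimensional (top_of_set (slice S (base z)))"
  then show "\<exists>\<sigma>. \<forall>\<gamma>. (\<forall>k. \<gamma> (2 * k) = \<sigma> (map \<gamma> [0..<2 * k])) \<longrightarrow> F z \<gamma> \<in> S"
    by (rule zero_dimensional_slice_imp_winning_strategy[OF lipschitz, rotated]) (simp add: base_def)
next
  assume "\<exists>\<sigma>. \<forall>\<gamma>. (\<forall>k. \<gamma> (2 * k) = \<sigma> (map \<gamma> [0..<2 * k])) \<longrightarrow> F z \<gamma> \<in> S"
  then obtain \<sigma> where \<sigma>: "\<And>\<gamma>. (\<And>k. \<gamma> (2 * k) = \<sigma> (map \<gamma> [0..<2 * k])) \<Longrightarrow> F z \<gamma> \<in> S" by blast
  show "zero_dimensional (top_of_set (slice S (base z)))"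
  proof (rule zero_dimensional_slice)
    fix u
    obtain h where "\<And>y k y'. agree k y y' \<Longrightarrow> \<bar>h y - h y'\<bar> \<le> 1 / 2 ^ k"
      "\<And>y. lo u < h y \<and> h y < hi u"
      "\<And>y. (\<forall>n. honest F z n y) \<or> finite {p. y p} \<Longrightarrow> won S y (h y)"
      using winning_strategy_imp_continuous_selection[OF lipschitz \<sigma>, where u = u] by metis
    then show "\<exists>h. (\<forall>y k y'. agree k y y' \<longrightarrow> \<bar>h y - h y'\<bar> \<le> 1 / 2 ^ k) \<and>
      (\<forall>y. lo u < h y \<and> h y < hi u) \<and> (\<forall>y\<in>base z. won S y (h y))"
      using base_cases by (intro exI[of _ h]) blast
  qed
qed

end

section \<open>Continuity in the Vietoris topology from a countable base\<close>

lemma closure_of_disjoint_open: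
  assumes "openin Y U" shows "U \<inter> Y closure_of A = {} \<longleftrightarrow> U \<inter> A = {}"
  using openin_Int_closure_of_eq_empty[OF assms] by blast

text \<open>Meeting an open set is witnessed by one basic set. Being contained in one is witnessed
  by finitely many missed basic sets, by compactness of the complement; the largest index bounds the
  coordinates of \<open>z\<close> involved.\<close>

lemma continuous_map_into_vietoris_closure:
  fixes G :: "(nat \<Rightarrow> bool) \<Rightarrow> 'a set"
  assumes Y: "compact_space Y"
    and W: "\<And>n. openin Y (W n)" "\<And>U x. openin Y U \<Longrightarrow> x \<in> U \<Longrightarrow> \<exists>n::nat. x \<in> W n \<and> W n \<subseteq> U"
    and sub: "\<And>z. G z \<subseteq> topspace Y"
    and decided: "\<And>n z z'. agree n z z' \<Longrightarrow> W n \<inter> G z \<noteq> {} \<Longrightarrow> W n \<inter> G z' \<noteq> {}"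
  shows "continuous_map euclidean (vietoris Y) (\<lambda>z. Y closure_of G z)"
  unfolding vietoris_def
proof (rule continuous_on_generated_topo)
  have comp: "compactin Y (Y closure_of G z)" for z
    using Y by (intro closedin_compact_space) auto
  let ?S = "{{K. compactin Y K \<and> K \<subseteq> U} | U. openin Y U} \<union> {{K. compactin Y K \<and> K \<inter> U \<noteq> {}} | U. openin Y U}"
  have "Y closure_of G z \<in> \<Union>?S" for z
  proof -
    have "Y closure_of G z \<in> {K. compactin Y K \<and> K \<subseteq> topspace Y}"
      using comp by (simp add: closure_of_subset_topspace)
    moreover have "{K. compactin Y K \<and> K \<subseteq> topspace Y} \<in> ?S" by blast
    ultimately show ?thesis by (rule UnionI[rotated])
  qed
  then show "(\<lambda>z. Y closure_of G z) ` topspace euclidean \<subseteq> \<Union>?S" by (intro image_subsetI)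
  fix \<U> assume "\<U> \<in> ?S"
  then have "open ((\<lambda>z. Y closure_of G z) -` \<U>)"
  proof (elim UnE CollectE exE conjE)
    fix U assume \<U>: "\<U> = {K. compactin Y K \<and> K \<subseteq> U}" and U: "openin Y U"
    show ?thesis
      unfolding open_seq_iff
    proof
      fix z assume "z \<in> (\<lambda>z. Y closure_of G z) -` \<U>"
      then have sub_U: "Y closure_of G z \<subseteq> U" by (simp add: \<U>)
      let ?I = "{n. W n \<inter> G z = {}}"
      have "compactin Y (topspace Y - U)" using Y U by (intro closedin_compact_space) auto
      moreover have "topspace Y - U \<subseteq> \<Union>(W ` ?I)"
      proof
        fix x assume "x \<in> topspace Y - U"
        then have "x \<in> topspace Y - Y closure_of G z" using sub_U by blast
        from W(2)[OF openin_diff[OF openin_topspace closedin_closure_of] this] obtain n where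
          n: "x \<in> W n" "W n \<subseteq> topspace Y - Y closure_of G z" by blast
        then have "W n \<inter> Y closure_of G z = {}" by blast
        then show "x \<in> \<Union>(W ` ?I)" using n(1) closure_of_disjoint_open[OF W(1)] by blast
      qed
      ultimately obtain \<F> where \<F>: "finite \<F>" "\<F> \<subseteq> W ` ?I" "topspace Y - U \<subseteq> \<Union>\<F>"
        using compactinD[of Y "topspace Y - U" "W ` ?I"] W(1) by blast
      then obtain J where J: "finite J" "J \<subseteq> ?I" "\<F> = W ` J" by (meson finite_subset_image)
      obtain m where m: "\<And>n. n \<in> J \<Longrightarrow> n \<le> m" using J(1) by (meson finite_nat_set_iff_bounded_le)
      have "Y closure_of G z' \<subseteq> U" if "agree m z z'" for z'
      proof
        fix x assume x: "x \<in> Y closure_of G z'"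
        show "x \<in> U"
        proof (rule ccontr)
          assume "x \<notin> U"
          then have "x \<in> topspace Y - U" using x closure_of_subset_topspace[of Y "G z'"] by blast
          then obtain n where n: "n \<in> J" "x \<in> W n" using \<F>(3) J(3) by blast
          have "agree n z' z" using agree_sym[OF agree_mono[OF that m[OF n(1)]]] .
          then have "W n \<inter> G z' = {}" using decided[of n z' z] n(1) J(2) by blast
          then show False using closure_of_disjoint_open[OF W(1)] n(2) x by blast
        qed
      qed
      then show "\<exists>n. \<forall>z'. agree n z z' \<longrightarrow> z' \<in> (\<lambda>z. Y closure_of G z) -` \<U>"
        using comp by (intro exI[of _ m]) (simp add: \<U>)
    qed
  next
    fix U assume \<U>: "\<U> = {K. compactin Y K \<and> K \<inter> U \<noteq> {}}" and U: "openin Y U"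
    show ?thesis
      unfolding open_seq_iff
    proof
      fix z assume "z \<in> (\<lambda>z. Y closure_of G z) -` \<U>"
      then have "U \<inter> G z \<noteq> {}" using closure_of_disjoint_open[OF U, of "G z"] by (auto simp: \<U>)
      then obtain x where x: "x \<in> U" "x \<in> G z" by blast
      obtain n where n: "x \<in> W n" "W n \<subseteq> U" using W(2)[OF U x(1)] by blast
      have "Y closure_of G z' \<inter> U \<noteq> {}" if "agree n z z'" for z'
      proof -
        have "W n \<inter> G z' \<noteq> {}" using decided[OF that] n(1) x(2) by blast
        then have "U \<inter> G z' \<noteq> {}" using n(2) by blast
        then show ?thesis using closure_of_disjoint_open[OF U, of "G z'"] by blast
      qed
      then show "\<exists>n. \<forall>z'. agree n z z' \<longrightarrow> z' \<in> (\<lambda>z. Y closure_of G z) -` \<U>"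
        using comp by (intro exI[of _ n]) (simp add: \<U>)
    qed
  qed
  then show "openin euclidean ((\<lambda>z. Y closure_of G z) -` \<U> \<inter> topspace euclidean)" by simp
qed

section \<open>Hardness for every admissible topology\<close>

theorem theorem1p2:
  fixes r :: "'o rel" and \<xi> :: 'o
  assumes "Well_order r" and "\<xi> \<in> Field r"
    and "countable (underS r \<xi>)" and "rank_ge r \<xi> 3"
  shows "\<exists>X :: ((nat \<Rightarrow> bool) \<times> real) set.
    pi0 r (top_of_set (UNIV \<times> {0..1})) \<xi> X \<and>
    (\<forall>\<T>. admissible_topology (top_of_set X) \<T> \<longrightarrow>
      zero_dim_hard (game_class (\<lambda>W. sigma0 r W \<xi>) euclidean) (top_of_set X) \<T>)"
proof (intro exI conjI allI impI)
  let ?S = "complete_set r \<xi>"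
  let ?X = "arena ?S"
  show "pi0 r (top_of_set (UNIV \<times> {0..1})) \<xi> ?X" by (rule pi0_arena[OF assms(1,2,4)])
  fix \<T> assume "admissible_topology (top_of_set ?X) \<T>"
  then obtain Y :: "(nat \<Rightarrow> real) topology" and e where
    Y: "compact_space Y" "metrizable_space Y" and e: "embedding_map (top_of_set ?X) Y e" and
    \<T>: "\<T> = pullback_topology (closed_subsets (top_of_set ?X)) (\<lambda>F. Y closure_of (e ` F)) (vietoris Y)"
    unfolding admissible_topology_def by blast
  have cont: "continuous_map (top_of_set ?X) Y e"
    using homeomorphic_imp_continuous_map[OF e[unfolded embedding_map_def]]
    by (simp add: continuous_map_in_subtopology)
  obtain O' where O': "\<And>n::nat. openin Y (O' n)"
    "\<And>U x. openin Y U \<Longrightarrow> x \<in> U \<Longrightarrow> \<exists>n. x \<in> O' n \<and> O' n \<subseteq> U"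
    using compact_metrizable_countable_base[OF Y] by blast
  show "zero_dim_hard (game_class (\<lambda>W. sigma0 r W \<xi>) euclidean) (top_of_set ?X) \<T>"
    unfolding zero_dim_hard_def
  proof (intro allI impI)
    fix A :: "(nat \<Rightarrow> bool) set" assume "game_class (\<lambda>W. sigma0 r W \<xi>) euclidean A"
    then obtain B :: "((nat \<Rightarrow> bool) \<times> (nat \<Rightarrow> nat)) set" where
      B: "sigma0 r euclidean \<xi> B" and A: "A = game_set euclidean B"
      by (auto simp: game_class_def)
    obtain F where F: "lipschitz_game F" "\<And>z \<gamma>. (z, \<gamma>) \<in> B \<longleftrightarrow> F z \<gamma> \<in> ?S"
      using sigma0_complete_set_reduction[OF assms(1-3) B] by blast
    \<comment> \<open>\<open>?X\<close> is fixed before the compactification is given;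
      \<open>Y\<close> and \<open>e\<close> influence only the points added to the honest ones,
      through these traces.\<close>
    define W where "W n = {p \<in> ?X. e p \<in> O' n}" for n
    have "openin (top_of_set ?X) (W n)" for n
      using openin_continuous_map_preimage[OF cont O'(1)[of n]] by (simp add: W_def)
    then interpret junk F ?S W using F(1) by unfold_locales
    define \<phi> where "\<phi> z = slice ?S (base z)" for z
    have sub: "\<phi> z \<subseteq> ?X" for z by (auto simp: \<phi>_def slice_def)
    have W_iff: "O' n \<inter> e ` \<phi> z \<noteq> {} \<longleftrightarrow> \<phi> z \<inter> W n \<noteq> {}" for n z
      using sub[of z] by (auto simp: W_def)
    have "continuous_map euclidean (vietoris Y) (\<lambda>z. Y closure_of (e ` \<phi> z))"
    proof (rule continuous_map_into_vietoris_closure[OF Y(1) O'])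
      show "e ` \<phi> z \<subseteq> topspace Y" for z
        using continuous_map_image_subset_topspace[OF cont] sub[of z] by auto
      show "O' n \<inter> e ` \<phi> z' \<noteq> {}" if "agree n z z'" "O' n \<inter> e ` \<phi> z \<noteq> {}" for n z z'
        using slice_meets_cong[OF that(1), folded \<phi>_def] that(2) unfolding W_iff .
    qed auto
    then have "continuous_map euclidean \<T> \<phi>"
      unfolding \<T> using closedin_slice
      by (intro continuous_map_pullback') (auto simp: o_def closed_subsets_def \<phi>_def)
    moreover have "A = \<phi> -` zero_dim_closed_subsets (top_of_set ?X)"
    proof -
      have "z \<in> A \<longleftrightarrow> \<phi> z \<in> zero_dim_closed_subsets (top_of_set ?X)" for z
      proof -
        have "subtopology (top_of_set ?X) (\<phi> z) = top_of_set (\<phi> z)"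
          using sub[of z] by (simp add: subtopology_subtopology Int_absorb1)
        then have "\<phi> z \<in> zero_dim_closed_subsets (top_of_set ?X) \<longleftrightarrow> zero_dimensional (top_of_set (\<phi> z))"
          using closedin_slice[of z] by (simp add: zero_dim_closed_subsets_def \<phi>_def)
        also have "\<dots> \<longleftrightarrow> z \<in> A"
          unfolding \<phi>_def zero_dimensional_slice_iff A
          by (simp add: game_set_def player_I_wins_def F(2))
        finally show ?thesis by simp
      qed
      then show ?thesis by auto
    qed
    ultimately show "\<exists>\<phi>. continuous_map euclidean \<T> \<phi> \<and> A = \<phi> -` zero_dim_closed_subsets (top_of_set ?X)"
      by blast
  qed
qed

end
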